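(* Let $n\ge 5$. The Krull dimension of $S_{G_n}/J_{G_n}$ is $2n+1$. Moreover, for $T\in\mathcal C(G_n)$, the following assertions hold: (i) If $T=\varnothing$, then $\dim(S_{G_n}/P_T(G_n))=2n+1$. (ii) If $T=X$ or $T=Y$, then $\dim(S_{G_n}/P_T(G_n))=2n$. (iii) If $\varnothing\ne T\subsetneq X$ or $\varnothing\neq T\subsetneq Y$, then $\dim(S_{G_n}/P_T(G_n))=n+4$. (iv) If $T$ meets both bipartition classes $X$ and $Y$, then $\dim(S_{G_n}/P_T(G_n))=8$.
   Context: Graph $G_n$: let $X=\{u_0,\dots,u_{n-1}\}$ and $Y=\{v_0,\dots,v_{n-1}\}$ be disjoint, indices modulo $n$. $G_n$ is the bipartite graph on $X\sqcup Y$ with $\{u_i,v_j\}\in E(G_n)$ iff $j\notin\{i,i-1\}$ modulo $n$ (the bipartite complement of the cycle $C_{2n}$ with edges $\{u_i,v_i\},\{u_i,v_{i-1}\}$). Binomial edge ideals: let $\mathbb K$ be an arbitrary field. For a finite simple graph $G$, $S_G=\mathbb K[x_w,y_w: w\in V(G)]$ (standard graded) and $J_G$ is the ideal generated by $x_ay_b-x_by_a$ for all edges $\{a,b\}\in E(G)$. For $T\subseteq V(G)$ let $c_G(T)$ be the number of connected components of the induced subgraph $G[V(G)\setminus T]$ (with $c_G(V(G))=0$); let $G_1,\dots,G_{c_G(T)}$ be these components and $\widetilde G_j$ the complete graph on $V(G_j)$. Put $P_T(G)=(x_i,y_i:i\in T)+\sum_j J_{\widetilde G_j}\subseteq S_G$.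 $T$ has the cut point property if $T=\varnothing$ or $c_G(T\setminus\{i\})<c_G(T)$ for every $i\in T$; $\mathcal C(G)$ is the set of all such $T$. (The minimal primes of $J_G$ are exactly the ideals $P_T(G)$, $T\in\mathcal C(G)$.) *)

theory Defs
  imports "HOL-Algebra.QuotRing" "HOL-Library.Poly_Mapping" "HOL-Library.Extended_Nat"
begin

section \<open>Krull dimension\<close>

text \<open>
  The supremum of the lengths \<open>n\<close> of chains \<open>p\<^sub>0 \<subset> \<dots> \<subset> p\<^sub>n\<close> of prime ideals.
  The zero ring has no prime ideals and gets dimension \<open>0\<close> here; every other ring gets its
  usual dimension.
\<close>

definition krull_dim :: "('a, 'b) ring_scheme \<Rightarrow> enat" where
  "krull_dim R =
     (SUP n \<in> {n. \<exists>p :: nat \<Rightarrow> 'a set.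
                  (\<forall>i\<le>n. primeideal (p i) R) \<and> (\<forall>i<n. p i \<subset> p (Suc i))}. enat n)"


section \<open>Polynomial rings\<close>

text \<open>
  A polynomial maps monomials (finitely supported exponent vectors) to coefficients.  All
  polynomials over the type \<^typ>\<open>'x\<close> of indeterminates form the commutative ring
  \<open>('x, 'k) mpoly\<close>; the polynomial ring in a given set \<open>A\<close> of indeterminates is its
  subring of polynomials in which only elements of \<open>A\<close> occur.
\<close>

type_synonym ('x, 'k) mpoly = "('x \<Rightarrow>\<^sub>0 nat) \<Rightarrow>\<^sub>0 'k"

definition mpoly_ring :: "'k::field itself \<Rightarrow> 'x set \<Rightarrow> ('x, 'k) mpoly ring" where
  "mpoly_ring K A =
     \<lparr>carrier = {p. \<forall>m \<in> Poly_Mapping.keys p. Poly_Mapping.keys m \<subseteq> A},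
      monoid.mult = (*), one = 1, ring.zero = 0, add = (+)\<rparr>"

definition indet :: "'x \<Rightarrow> ('x, 'k::field) mpoly" where
  "indet z = Poly_Mapping.single (Poly_Mapping.single z 1) 1"

lemma mpoly_ring_cring: "cring (mpoly_ring K A)"
proof -
  let ?R = "mpoly_ring K A"
  let ?C = "carrier ?R"
  have memI: "p \<in> ?C" if "\<And>m. m \<in> Poly_Mapping.keys p \<Longrightarrow> Poly_Mapping.keys m \<subseteq> A" for p
    using that by (simp add: mpoly_ring_def)
  have memD: "Poly_Mapping.keys m \<subseteq> A" if "p \<in> ?C" "m \<in> Poly_Mapping.keys p" for p m
    using that by (simp add: mpoly_ring_def)
  have ops [simp]: "x \<oplus>\<^bsub>?R\<^esub> y = x + y" "x \<otimes>\<^bsub>?R\<^esub> y = x * y" "\<zero>\<^bsub>?R\<^esub> = 0" "\<one>\<^bsub>?R\<^esub> = 1" for x y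
    by (simp_all add: mpoly_ring_def)
  have cl_add: "p + q \<in> ?C" if "p \<in> ?C" "q \<in> ?C" for p q
    by (rule memI) (use that memD Poly_Mapping.keys_add[of p q] in blast)
  have cl_mult: "p * q \<in> ?C" if "p \<in> ?C" "q \<in> ?C" for p q
  proof (rule memI)
    fix m assume "m \<in> Poly_Mapping.keys (p * q)"
    then obtain a b where "m = a + b" "a \<in> Poly_Mapping.keys p" "b \<in> Poly_Mapping.keys q"
      using keys_mult[of p q] by blast
    then show "Poly_Mapping.keys m \<subseteq> A"
      using Poly_Mapping.keys_add[of a b] memD[OF \<open>p \<in> ?C\<close>] memD[OF \<open>q \<in> ?C\<close>] by blast
  qed
  have cl_0: "0 \<in> ?C" and cl_1: "1 \<in> ?C"
    by (rule memI, simp)+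
  have cl_uminus: "- p \<in> ?C" if "p \<in> ?C" for p
    by (rule memI) (use memD[OF that] in simp)
  have "abelian_group ?R"
  proof (rule abelian_groupI)
    show "\<exists>q \<in> ?C. q \<oplus>\<^bsub>?R\<^esub> p = \<zero>\<^bsub>?R\<^esub>" if "p \<in> ?C" for p
      by (rule bexI[OF _ cl_uminus[OF that]]) simp
  qed (simp_all add: cl_add cl_0 add.assoc add.commute)
  moreover have "Group.comm_monoid ?R"
    by (rule comm_monoidI) (simp_all add: cl_mult cl_1 mult.assoc mult.commute)
  ultimately show ?thesis
    by (rule cringI) (simp add: distrib_right)
qed


section \<open>Finite simple graphs and cut sets\<close>

record 'v ugraph =
  verts :: "'v set"
  edges :: "'v set set"

definition simple_graph :: "'v ugraph \<Rightarrow> bool" where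
  "simple_graph G \<longleftrightarrow>
     finite (verts G) \<and> (\<forall>e \<in> edges G. e \<subseteq> verts G \<and> card e = 2)"

definition induced :: "'v ugraph \<Rightarrow> 'v set \<Rightarrow> 'v ugraph" where
  "induced G W = \<lparr>verts = verts G \<inter> W, edges = {e \<in> edges G. e \<subseteq> W}\<rparr>"

definition complete_graph :: "'v set \<Rightarrow> 'v ugraph" where
  "complete_graph C = \<lparr>verts = C, edges = {{a, b} | a b. a \<in> C \<and> b \<in> C \<and> a \<noteq> b}\<rparr>"

text \<open>Connected components are represented by their vertex sets.\<close>

definition components :: "'v ugraph \<Rightarrow> 'v set set" where
  "components G =
     verts G // {(a, b). a \<in> verts G \<and> b \<in> verts G \<and> (a, b) \<in> {(a, b). {a, b} \<in> edges G}\<^sup>*}"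

definition comps_del :: "'v ugraph \<Rightarrow> 'v set \<Rightarrow> 'v set set" where
  "comps_del G T = components (induced G (verts G - T))"

definition num_comps :: "'v ugraph \<Rightarrow> 'v set \<Rightarrow> nat" where
  "num_comps G T = card (comps_del G T)"

definition cut_sets :: "'v ugraph \<Rightarrow> 'v set set" where
  "cut_sets G =
     {T. T \<subseteq> verts G \<and> (T = {} \<or> (\<forall>i \<in> T. num_comps G (T - {i}) < num_comps G T))}"


section \<open>Binomial edge ideals\<close>

datatype 'v xy = Xv 'v | Yv 'v

definition bei_ring :: "'k::field itself \<Rightarrow> 'v ugraph \<Rightarrow> ('v xy, 'k) mpoly ring" where
  "bei_ring K G = mpoly_ring K (Xv ` verts G \<union> Yv ` verts G)"

text \<open>
  An edge \<open>{a, b}\<close> contributes the binomial both for \<open>(a, b)\<close> and for \<open>(b, a)\<close>;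
  the two differ by a sign.
\<close>

definition edge_binomials :: "'k::field itself \<Rightarrow> 'v ugraph \<Rightarrow> ('v xy, 'k) mpoly set" where
  "edge_binomials K G =
     {indet (Xv a) * indet (Yv b) - indet (Xv b) * indet (Yv a) | a b. {a, b} \<in> edges G}"

definition bei :: "'k::field itself \<Rightarrow> 'v ugraph \<Rightarrow> ('v xy, 'k) mpoly set" where
  "bei K G = genideal (bei_ring K G) (edge_binomials K G)"

text \<open>
  A sum of ideals of \<open>S\<^sub>G\<close> given by generators is the ideal generated by the union of the
  generating sets.
\<close>

definition P_ideal :: "'k::field itself \<Rightarrow> 'v ugraph \<Rightarrow> 'v set \<Rightarrow> ('v xy, 'k) mpoly set" where
  "P_ideal K G T =
     genideal (bei_ring K G)
       (indet ` (Xv ` T \<union> Yv ` T) \<union>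
        (\<Union>C \<in> comps_del G T. edge_binomials K (complete_graph C)))"


section \<open>The bipartite complement of the cycle on 2n vertices\<close>

datatype bvert = U nat | V nat

definition X_class :: "nat \<Rightarrow> bvert set" where
  "X_class n = U ` {..<n}"

definition Y_class :: "nat \<Rightarrow> bvert set" where
  "Y_class n = V ` {..<n}"

text \<open>For \<open>i < n\<close>, the residue of \<open>i - 1\<close> modulo \<open>n\<close> is written \<open>(i + n - 1) mod n\<close>.\<close>

definition Gn :: "nat \<Rightarrow> bvert ugraph" where
  "Gn n = \<lparr>verts = X_class n \<union> Y_class n,
           edges = {{U i, V j} | i j. i < n \<and> j < n \<and> j \<noteq> i \<and> j \<noteq> (i + n - 1) mod n}\<rparr>"

lemma simple_graph_Gn: "simple_graph (Gn n)"
  by (auto simp: simple_graph_def Gn_def X_class_def Y_class_def)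

end

theory Submission
  imports Defs
begin

text \<open>
  For a finite graph \<open>G\<close> with vertex set \<open>V\<close> and \<open>T \<subseteq> V\<close> put \<open>f(T) = |V - T| + c(T)\<close>.  The theorem
  combines three facts.

  \<^item> The ring \<open>S/P\<^sub>T\<close> has dimension \<open>f(T)\<close> (\<open>krull_dim_P_ideal\<close>).  It is parametrised by
  \<open>x\<^sub>a \<mapsto> z\<^sub>a\<close>, \<open>y\<^sub>a \<mapsto> z\<^sub>a w\<^sub>C\<close> for \<open>a\<close> in the component \<open>C\<close>, which involves \<open>f(T)\<close> parameters;
  setting them to zero one after the other gives a chain of \<open>f(T)\<close> strict inclusions between prime
  kernels.  No longer chain exists: if \<open>p\<^sub>0 \<subset> \<dots> \<subset> p\<^sub>m\<close> are primes and \<open>g\<^sub>i \<in> p\<^sub>i\<^sub>+\<^sub>1 - p\<^sub>i\<close>, then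
  \<open>g\<^sub>0, \<dots>, g\<^sub>m\<^sub>-\<^sub>1\<close> are algebraically independent modulo \<open>p\<^sub>0\<close> (\<open>chain_independent\<close>), whereas modulo
  a prime above \<open>P\<^sub>T\<close> every indeterminate is a quotient of polynomials in at most \<open>f(T)\<close> of them,
  so that \<open>m \<le> f(T)\<close> by counting monomials (\<open>prime_chain_length_le\<close>).

  \<^item> The dimension of \<open>S/J\<^sub>G\<close> is the maximum of \<open>f\<close> (\<open>krull_dim_bei\<close>), because a prime \<open>p\<close> above
  \<open>J\<^sub>G\<close> contains \<open>P\<^sub>T\<close> for the set \<open>T\<close> of vertices \<open>v\<close> with \<open>x\<^sub>v, y\<^sub>v \<in> p\<close>: outside \<open>T\<close>,
  proportionality of the vectors \<open>(x\<^sub>v, y\<^sub>v)\<close> modulo \<open>p\<close> is transitive and so spreads from edges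
  to components.  The maximum is attained at a cut set, since dropping from \<open>T\<close> a vertex that
  violates the cut point property makes \<open>f\<close> larger (\<open>cut_set_maximises\<close>).

  \<^item> For \<open>G\<^sub>n\<close> the values of \<open>f\<close> on cut sets are found by hand.  Two observations carry the case
  analysis: a vertex in some component is adjacent in the cycle \<open>C\<^sub>2\<^sub>n\<close> to every vertex of the
  other side that remains outside this component, and there are at most two such vertices
  (\<open>card_outside_comp\<close>); and each vertex of a cut set has neighbours in two different components
  (\<open>cut_neighbours\<close>).  Together they leave only few shapes for \<open>G\<^sub>n - T\<close>.
\<close>

section \<open>Polynomials in a given set of indeterminates\<close>

abbreviation polys :: "'k::field itself \<Rightarrow> 'x set \<Rightarrow> ('x, 'k) mpoly set" where
  "polys K A \<equiv> carrier (mpoly_ring K A)"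

definition const :: "'k \<Rightarrow> ('x, 'k::field) mpoly" where
  "const c = Poly_Mapping.single 0 c"

lemma mpoly_ring_ops [simp]:
  "x \<oplus>\<^bsub>mpoly_ring K A\<^esub> y = x + y" "x \<otimes>\<^bsub>mpoly_ring K A\<^esub> y = x * y"
  "\<zero>\<^bsub>mpoly_ring K A\<^esub> = 0" "\<one>\<^bsub>mpoly_ring K A\<^esub> = 1"
  by (simp_all add: mpoly_ring_def)

lemma polys_iff: "p \<in> polys K A \<longleftrightarrow> (\<forall>m \<in> Poly_Mapping.keys p. Poly_Mapping.keys m \<subseteq> A)"
  by (simp add: mpoly_ring_def)

lemma polys_closed [intro, simp]:
  shows "0 \<in> polys K A" and "1 \<in> polys K A"
    and "p \<in> polys K A \<Longrightarrow> q \<in> polys K A \<Longrightarrow> p + q \<in> polys K A"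
    and "p \<in> polys K A \<Longrightarrow> q \<in> polys K A \<Longrightarrow> p * q \<in> polys K A"
proof -
  interpret cring "mpoly_ring K A" by (rule mpoly_ring_cring)
  show "0 \<in> polys K A" "1 \<in> polys K A" using zero_closed one_closed by simp_all
  show "p \<in> polys K A \<Longrightarrow> q \<in> polys K A \<Longrightarrow> p + q \<in> polys K A"
    using a_closed[of p q] by simp
  show "p \<in> polys K A \<Longrightarrow> q \<in> polys K A \<Longrightarrow> p * q \<in> polys K A"
    using m_closed[of p q] by simp
qed

lemma polys_uminus [intro, simp]: "p \<in> polys K A \<Longrightarrow> - p \<in> polys K A"
  by (simp add: polys_iff)

lemma polys_diff [intro, simp]: "p \<in> polys K A \<Longrightarrow> q \<in> polys K A \<Longrightarrow> p - q \<in> polys K A"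
  using polys_closed(3)[of p K A "- q"] by simp

lemma a_inv_mpoly_ring: "p \<in> polys K A \<Longrightarrow> \<ominus>\<^bsub>mpoly_ring K A\<^esub> p = - p"
proof -
  interpret cring "mpoly_ring K A" by (rule mpoly_ring_cring)
  show "p \<in> polys K A \<Longrightarrow> \<ominus>\<^bsub>mpoly_ring K A\<^esub> p = - p"
    using minus_equality[of "- p" p] by simp
qed

lemma polys_power [intro, simp]: "p \<in> polys K A \<Longrightarrow> p ^ (n::nat) \<in> polys K A"
  by (induction n) auto

lemma polys_prod [intro]: "(\<And>i. i \<in> I \<Longrightarrow> f i \<in> polys K A) \<Longrightarrow> prod f I \<in> polys K A"
  by (induction I rule: infinite_finite_induct) auto

lemma polys_sum [intro]: "(\<And>i. i \<in> I \<Longrightarrow> f i \<in> polys K A) \<Longrightarrow> sum f I \<in> polys K A"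
  by (induction I rule: infinite_finite_induct) auto

lemma const_in_polys [intro, simp]: "const c \<in> polys K A"
  by (simp add: polys_iff const_def)

lemma indet_in_polys [intro, simp]: "z \<in> A \<Longrightarrow> indet z \<in> polys K A"
  by (simp add: polys_iff indet_def)

lemma polys_mono: "A \<subseteq> B \<Longrightarrow> polys K A \<subseteq> polys K B"
  by (fastforce simp: polys_iff)

lemma const_mult: "const a * const b = const (a * b)"
  by (simp add: const_def mult_single)

lemma lookup_const_mult: "Poly_Mapping.lookup (const c * p) m = c * Poly_Mapping.lookup p m"
  unfolding const_def mult_map_scale_conv_mult[symmetric] by (simp add: Poly_Mapping.map.rep_eq when_def)

lemma const_1: "const 1 = 1"
  by (simp add: const_def)

lemma poly_as_sum_of_monomials:
  "p = (\<Sum>m\<in>Poly_Mapping.keys p. Poly_Mapping.single m (Poly_Mapping.lookup p m))"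
  by (rule poly_mapping_eqI)
     (simp add: lookup_sum lookup_single when_def in_keys_iff sum.delta)

lemma monomial_as_prod_of_indets:
  "Poly_Mapping.single m c = const c * (\<Prod>z\<in>Poly_Mapping.keys m. indet z ^ Poly_Mapping.lookup m z)"
proof -
  have pow: "indet z ^ k = Poly_Mapping.single (Poly_Mapping.single z k) 1" for z :: 'a and k
    by (induction k) (simp_all add: indet_def mult_single flip: single_add)
  have "(\<Prod>z\<in>I. indet z ^ h z) = (Poly_Mapping.single (\<Sum>z\<in>I. Poly_Mapping.single z (h z)) 1 :: ('a, 'b) mpoly)"
    if "finite I" for I h
    using that by (induction) (simp_all add: pow mult_single)
  moreover have "(\<Sum>z\<in>Poly_Mapping.keys m. Poly_Mapping.single z (Poly_Mapping.lookup m z)) = m"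
    by (rule poly_mapping_eqI)
       (simp add: lookup_sum lookup_single when_def in_keys_iff sum.delta)
  ultimately show ?thesis
    by (simp add: const_def mult_single)
qed

lemma polys_induct [consumes 1, case_names const indet add mult]:
  assumes "p \<in> polys K A"
    and "\<And>c. Q (const c)" and "\<And>z. z \<in> A \<Longrightarrow> Q (indet z)"
    and add: "\<And>p q. p \<in> polys K A \<Longrightarrow> q \<in> polys K A \<Longrightarrow> Q p \<Longrightarrow> Q q \<Longrightarrow> Q (p + q)"
    and mult: "\<And>p q. p \<in> polys K A \<Longrightarrow> q \<in> polys K A \<Longrightarrow> Q p \<Longrightarrow> Q q \<Longrightarrow> Q (p * q)"
  shows "Q p"
proof -
  let ?G = "{p \<in> polys K A. Q p}"
  have c: "const c \<in> ?G" for c using assms(2) by simp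
  have 0: "0 \<in> ?G" using c[of 0] by (simp add: const_def)
  have 1: "1 \<in> ?G" using c[of 1] by (simp add: const_def)
  have sum: "sum f I \<in> ?G" if "\<And>i. i \<in> I \<Longrightarrow> f i \<in> ?G" for f and I :: "('a \<Rightarrow>\<^sub>0 nat) set"
    using that by (induction I rule: infinite_finite_induct) (use 0 add in auto)
  have pow: "p ^ k \<in> ?G" if "p \<in> ?G" for p and k :: nat
    using that by (induction k) (use 1 mult in auto)
  have prod: "prod f I \<in> ?G" if "\<And>i. i \<in> I \<Longrightarrow> f i \<in> ?G" for f and I :: "'a set"
    using that by (induction I rule: infinite_finite_induct) (use 1 mult in auto)
  have "(\<Sum>m\<in>Poly_Mapping.keys p. Poly_Mapping.single m (Poly_Mapping.lookup p m)) \<in> ?G"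
  proof (rule sum)
    fix m assume m: "m \<in> Poly_Mapping.keys p"
    have pr: "(\<Prod>z\<in>Poly_Mapping.keys m. indet z ^ Poly_Mapping.lookup m z) \<in> ?G"
    proof (rule prod)
      fix z assume "z \<in> Poly_Mapping.keys m"
      then have "z \<in> A" using m assms(1) by (auto simp: polys_iff)
      then show "indet z ^ Poly_Mapping.lookup m z \<in> ?G"
        by (intro pow) (use assms(3) in auto)
    qed
    show "Poly_Mapping.single m (Poly_Mapping.lookup p m) \<in> ?G"
      unfolding monomial_as_prod_of_indets[of m] using c pr mult by simp
  qed
  then show ?thesis by (simp flip: poly_as_sum_of_monomials)
qed

section \<open>Prime ideals\<close>

lemma ideal_mpolyD:
  assumes "ideal P (mpoly_ring K A)"
  shows "P \<subseteq> polys K A" "0 \<in> P"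
    and "p \<in> P \<Longrightarrow> q \<in> P \<Longrightarrow> p + q \<in> P"
    and "p \<in> P \<Longrightarrow> - p \<in> P"
    and "p \<in> P \<Longrightarrow> q \<in> P \<Longrightarrow> p - q \<in> P"
    and "p \<in> P \<Longrightarrow> r \<in> polys K A \<Longrightarrow> p * r \<in> P"
    and "p \<in> P \<Longrightarrow> r \<in> polys K A \<Longrightarrow> r * p \<in> P"
proof -
  interpret ideal P "mpoly_ring K A" by fact
  show sub: "P \<subseteq> polys K A" using a_subset by simp
  show "0 \<in> P" using additive_subgroup.zero_closed[OF additive_subgroup_axioms] by simp
  show add: "p + q \<in> P" if "p \<in> P" "q \<in> P" for p q
    using additive_subgroup.a_closed[OF additive_subgroup_axioms that] by simp
  show neg: "- p \<in> P" if "p \<in> P" for p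
    using additive_subgroup.a_inv_closed[OF additive_subgroup_axioms that]
      a_inv_mpoly_ring[of p K A] that sub by auto
  show "p - q \<in> P" if "p \<in> P" "q \<in> P"
    using add[OF that(1) neg[OF that(2)]] by simp
  show "p * r \<in> P" "r * p \<in> P" if "p \<in> P" "r \<in> polys K A"
    using I_r_closed[OF that] I_l_closed[OF that] by simp_all
qed

lemma primeideal_mpolyD:
  assumes "primeideal P (mpoly_ring K A)"
  shows "ideal P (mpoly_ring K A)" and "1 \<notin> P"
    and "p * q \<in> P \<Longrightarrow> p \<in> polys K A \<Longrightarrow> q \<in> polys K A \<Longrightarrow> p \<in> P \<or> q \<in> P"
proof -
  interpret primeideal P "mpoly_ring K A" by fact
  show "ideal P (mpoly_ring K A)" by (rule ideal_axioms)
  show "1 \<notin> P" using I_notcarr one_imp_carrier by auto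
  show "p * q \<in> P \<Longrightarrow> p \<in> polys K A \<Longrightarrow> q \<in> polys K A \<Longrightarrow> p \<in> P \<or> q \<in> P"
    using I_prime[of p q] by simp
qed

lemma primeideal_power:
  assumes "primeideal P (mpoly_ring K A)" "p ^ (n::nat) \<in> P" "p \<in> polys K A"
  shows "p \<in> P"
  using assms(2)
proof (induction n)
  case 0 then show ?case using primeideal_mpolyD(2)[OF assms(1)] by simp
next
  case (Suc n)
  then show ?case using primeideal_mpolyD(3)[OF assms(1), of p "p ^ n"] assms(3) by auto
qed

lemma primeideal_prod:
  assumes "primeideal P (mpoly_ring K A)" "prod f I \<in> P" "\<And>i. i \<in> I \<Longrightarrow> f i \<in> polys K A"
  shows "\<exists>i\<in>I. f i \<in> P"
  using assms(2,3)
proof (induction I rule: infinite_finite_induct)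
  case (insert i I)
  then have "f i * prod f I \<in> P" "f i \<in> polys K A" "prod f I \<in> polys K A" by auto
  then show ?case using primeideal_mpolyD(3)[OF assms(1)] insert by blast
qed (use primeideal_mpolyD(2)[OF assms(1)] in auto)

lemma const_notin_primeideal:
  assumes "primeideal P (mpoly_ring K A)" "c \<noteq> 0"
  shows "const c \<notin> P"
proof
  assume "const c \<in> P"
  then have "const c * const (inverse c) \<in> P"
    using ideal_mpolyD(6)[OF primeideal_mpolyD(1)[OF assms(1)]] by blast
  then show False
    using assms primeideal_mpolyD(2)[OF assms(1)] by (simp add: const_mult const_1)
qed

section \<open>Independence along a chain of primes\<close>

text \<open>
  Suppose that a polynomial \<open>Q \<noteq> 0\<close> takes a value in \<open>P k\<close> at \<open>(g k, \<dots>, g (m - 1))\<close>.  Since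
  \<open>g k \<notin> P k\<close>, the highest power of the first variable that divides \<open>Q\<close> can be cancelled.  The
  value of what is left lies in \<open>P k \<subseteq> P (k + 1)\<close>, which also contains \<open>g k\<close>; hence the part of
  \<open>Q\<close> that is free of the first variable, a nonzero polynomial, has its value in \<open>P (k + 1)\<close>.  At
  the end of the chain a nonzero constant lies in \<open>P m\<close>, which is impossible.
  
  Here \<open>Q\<close> is given by its exponent vectors \<open>E\<close> and coefficients \<open>c\<close>.  The vectors keep their
  entries outside \<open>{k..<m}\<close> during the induction; injectivity of the restriction says that they
  still stand for different monomials.
\<close>

lemma chain_independent:
  fixes P :: "nat \<Rightarrow> ('x, 'k::field) mpoly set" and c :: "(nat \<Rightarrow> nat) \<Rightarrow> 'k"
  assumes prime: "\<And>i. i \<le> m \<Longrightarrow> primeideal (P i) (mpoly_ring K A)"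
    and sub: "\<And>i. i < m \<Longrightarrow> P i \<subseteq> P (Suc i)"
    and g: "\<And>i. i < m \<Longrightarrow> g i \<in> P (Suc i) - P i"
    and "k \<le> m" "finite E" "E \<noteq> {}" "\<And>\<alpha>. \<alpha> \<in> E \<Longrightarrow> c \<alpha> \<noteq> 0"
    and "inj_on (\<lambda>\<alpha>. restrict \<alpha> {k..<m}) E"
  shows "(\<Sum>\<alpha>\<in>E. const (c \<alpha>) * (\<Prod>i\<in>{k..<m}. g i ^ \<alpha> i)) \<notin> P k"
  using assms(4-8)
proof (induction k arbitrary: E rule: inc_induct)
  case base
  have "\<alpha> = \<beta>" if "\<alpha> \<in> E" "\<beta> \<in> E" for \<alpha> \<beta>
    using base(4) that by (auto simp: inj_on_def)
  then obtain \<alpha> where "E = {\<alpha>}" using base(2) by blast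
  then show ?case
    using const_notin_primeideal[OF prime[of m]] base by simp
next
  case (step k)
  have gp: "g i \<in> polys K A" if "i < m" for i
    using ideal_mpolyD(1)[OF primeideal_mpolyD(1)[OF prime[of "Suc i"]]] g[OF that] that by auto
  have idk: "ideal (P k) (mpoly_ring K A)" "ideal (P (Suc k)) (mpoly_ring K A)"
    using primeideal_mpolyD(1)[OF prime] step by auto
  define a where "a = Min ((\<lambda>\<alpha>. \<alpha> k) ` E)"
  \<comment> \<open>the terms that survive modulo \<open>g k\<close> once \<open>g k ^ a\<close> has been cancelled\<close>
  define E0 where "E0 = {\<alpha>\<in>E. \<alpha> k = a}"
  have "a \<in> (\<lambda>\<alpha>. \<alpha> k) ` E" unfolding a_def using step by (intro Min_in) auto
  then have E0: "E0 \<noteq> {}" "finite E0" "E0 \<subseteq> E" using step by (auto simp: E0_def)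
  have amin: "a \<le> \<alpha> k" if "\<alpha> \<in> E" for \<alpha> unfolding a_def using that step by auto
  let ?G = "\<lambda>\<alpha>. \<Prod>i\<in>{Suc k..<m}. g i ^ \<alpha> i"
  let ?S0 = "\<Sum>\<alpha>\<in>E0. const (c \<alpha>) * ?G \<alpha>"
  let ?R = "\<Sum>\<alpha>\<in>E - E0. const (c \<alpha>) * (g k ^ (\<alpha> k - a - 1) * ?G \<alpha>)"
  have Gp: "?G \<alpha> \<in> polys K A" for \<alpha> by (intro polys_prod polys_power gp) auto
  have S0p: "?S0 \<in> polys K A" by (intro polys_sum polys_closed const_in_polys Gp)
  have Rp: "?R \<in> polys K A"
    using step by (intro polys_sum polys_closed const_in_polys Gp polys_power gp)
  have "restrict \<alpha> {k..<m} = restrict \<beta> {k..<m}"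
    if "\<alpha> \<in> E0" "\<beta> \<in> E0" "restrict \<alpha> {Suc k..<m} = restrict \<beta> {Suc k..<m}" for \<alpha> \<beta>
  proof
    fix i
    have "restrict \<alpha> {Suc k..<m} i = restrict \<beta> {Suc k..<m} i" by (rule fun_cong[OF that(3)])
    then show "restrict \<alpha> {k..<m} i = restrict \<beta> {k..<m} i"
      using that(1,2) step(1,2) by (cases "i = k") (auto simp: E0_def split: if_splits)
  qed
  then have "inj_on (\<lambda>\<alpha>. restrict \<alpha> {Suc k..<m}) E0"
    using step(7) E0(3) unfolding inj_on_def by (metis (no_types, lifting) subsetD)
  then have notin: "?S0 \<notin> P (Suc k)"
    using step.IH[of E0] E0 step by blast
  show ?case
  proof
    assume A: "(\<Sum>\<alpha>\<in>E. const (c \<alpha>) * (\<Prod>i\<in>{k..<m}. g i ^ \<alpha> i)) \<in> P k"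
    have split: "(\<Prod>i\<in>{k..<m}. g i ^ \<alpha> i) = g k ^ \<alpha> k * ?G \<alpha>" for \<alpha>
      using step by (simp add: prod.atLeast_Suc_lessThan)
    have "(\<Sum>\<alpha>\<in>E. const (c \<alpha>) * (\<Prod>i\<in>{k..<m}. g i ^ \<alpha> i))
      = (\<Sum>\<alpha>\<in>E0. const (c \<alpha>) * (g k ^ \<alpha> k * ?G \<alpha>)) + (\<Sum>\<alpha>\<in>E - E0. const (c \<alpha>) * (g k ^ \<alpha> k * ?G \<alpha>))"
      unfolding split using E0 step(4) by (metis (no_types, lifting) sum.subset_diff add.commute)
    also have "(\<Sum>\<alpha>\<in>E0. const (c \<alpha>) * (g k ^ \<alpha> k * ?G \<alpha>)) = g k ^ a * ?S0"
      unfolding sum_distrib_left by (intro sum.cong) (auto simp: E0_def mult_ac)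
    also have "(\<Sum>\<alpha>\<in>E - E0. const (c \<alpha>) * (g k ^ \<alpha> k * ?G \<alpha>)) = g k ^ a * (g k * ?R)"
      unfolding sum_distrib_left
    proof (intro sum.cong refl)
      fix \<alpha> assume "\<alpha> \<in> E - E0"
      then have "a < \<alpha> k" using amin[of \<alpha>] by (auto simp: E0_def)
      then have "\<alpha> k = a + (1 + (\<alpha> k - a - 1))" by simp
      then have "g k ^ \<alpha> k = g k ^ a * (g k * g k ^ (\<alpha> k - a - 1))"
        by (metis power_add power_one_right)
      then show "const (c \<alpha>) * (g k ^ \<alpha> k * ?G \<alpha>) =
        g k ^ a * (g k * (const (c \<alpha>) * (g k ^ (\<alpha> k - a - 1) * ?G \<alpha>)))"
        by (simp add: mult_ac)
    qed
    finally have "g k ^ a * (?S0 + g k * ?R) \<in> P k" using A by (simp add: distrib_left)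
    moreover have "g k ^ a \<notin> P k"
      using primeideal_power[OF prime[of k], of "g k" a] gp g step by auto
    ultimately have "?S0 + g k * ?R \<in> P k"
      using primeideal_mpolyD(3)[OF prime[of k], of "g k ^ a" "?S0 + g k * ?R"] step(1,2)
        S0p Rp gp by auto
    then have "?S0 + g k * ?R \<in> P (Suc k)" using sub step by auto
    moreover have "g k * ?R \<in> P (Suc k)"
      using ideal_mpolyD(6)[OF idk(2)] g step Rp by auto
    ultimately have "?S0 + g k * ?R - g k * ?R \<in> P (Suc k)"
      using ideal_mpolyD(5)[OF idk(2)] by blast
    then show False using notin by simp
  qed
qed

section \<open>Chains of primes and transcendence degree\<close>

text \<open>
  Gaussian elimination: each equation allows one unknown to be expressed by the others.
\<close>

lemma homogeneous_system_solution:
  fixes M :: "'j \<Rightarrow> 'i \<Rightarrow> 'k::field"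
  assumes "finite J" "finite I" "card J < card I"
  shows "\<exists>c. (\<exists>i\<in>I. c i \<noteq> 0) \<and> (\<forall>j\<in>J. (\<Sum>i\<in>I. c i * M j i) = 0)"
  using assms
proof (induction J arbitrary: I M rule: finite_induct)
  case empty
  then have "I \<noteq> {}" by auto
  then show ?case by (intro exI[of _ "\<lambda>_. 1"]) auto
next
  case (insert j J)
  show ?case
  proof (cases "\<forall>i\<in>I. M j i = 0")
    case True
    then show ?thesis using insert.IH[of I M] insert by auto
  next
    case False
    then obtain p where p: "p \<in> I" "M j p \<noteq> 0" by auto
    let ?I = "I - {p}" and ?M = "\<lambda>l i. M l i - M l p * M j i / M j p"
    have "card J < card ?I" using insert p by simp
    then obtain c where c: "\<exists>i\<in>?I. c i \<noteq> 0" "\<forall>l\<in>J. (\<Sum>i\<in>?I. c i * ?M l i) = 0"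
      using insert.IH[of ?I ?M] insert.prems by auto
    let ?s = "\<Sum>i\<in>?I. c i * M j i"
    let ?c = "c(p := - ?s / M j p)"
    have eq: "(\<Sum>i\<in>I. ?c i * M l i) = - ?s / M j p * M l p + (\<Sum>i\<in>?I. c i * M l i)" for l
    proof -
      have "(\<Sum>i\<in>?I. ?c i * M l i) = (\<Sum>i\<in>?I. c i * M l i)" by (intro sum.cong) auto
      then show ?thesis using insert.prems p by (subst sum.remove[of I p]) auto
    qed
    have "(\<Sum>i\<in>I. ?c i * M l i) = 0" if "l \<in> J" for l
    proof -
      have "0 = (\<Sum>i\<in>?I. c i * M l i - M l p / M j p * (c i * M j i))"
        using c(2)[rule_format, OF that] by (simp add: right_diff_distrib mult.left_commute)
      also have "\<dots> = (\<Sum>i\<in>?I. c i * M l i) - M l p / M j p * ?s"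
        by (simp add: sum_subtractf sum_distrib_left)
      finally show ?thesis unfolding eq by simp
    qed
    moreover have "(\<Sum>i\<in>I. ?c i * M j i) = 0" unfolding eq using p by simp
    moreover have "\<exists>i\<in>I. ?c i \<noteq> 0" using c(1) by auto
    ultimately show ?thesis by (intro exI[of _ ?c]) auto
  qed
qed

text \<open>
  Bounding every exponent separately, and not the total degree, makes the number of monomials
  at most a power with exponent \<open>card B\<close>.
\<close>

definition box_monomials :: "'x set \<Rightarrow> nat \<Rightarrow> ('x \<Rightarrow>\<^sub>0 nat) set" where
  "box_monomials B L = {m. Poly_Mapping.keys m \<subseteq> B \<and> (\<forall>z. Poly_Mapping.lookup m z \<le> L)}"

definition box_polys :: "'x set \<Rightarrow> nat \<Rightarrow> ('x, 'k::field) mpoly set" where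
  "box_polys B L = {p. Poly_Mapping.keys p \<subseteq> box_monomials B L}"

lemma card_box_monomials:
  assumes "finite B"
  shows "finite (box_monomials B L)" "card (box_monomials B L) \<le> (L + 1) ^ card B"
proof -
  let ?f = "\<lambda>m. restrict (Poly_Mapping.lookup m) B"
  have im: "?f ` box_monomials B L \<subseteq> B \<rightarrow>\<^sub>E {..L}"
    by (auto simp: box_monomials_def)
  have inj: "inj_on ?f (box_monomials B L)"
  proof (rule inj_onI)
    fix m m' assume *: "m \<in> box_monomials B L" "m' \<in> box_monomials B L" "?f m = ?f m'"
    have "Poly_Mapping.lookup m z = Poly_Mapping.lookup m' z" for z
    proof (cases "z \<in> B")
      case True then show ?thesis using fun_cong[OF *(3), of z] by simp
    next
      case False
      then have "z \<notin> Poly_Mapping.keys m" "z \<notin> Poly_Mapping.keys m'"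
        using * by (auto simp: box_monomials_def)
      then show ?thesis by (simp add: in_keys_iff)
    qed
    then show "m = m'" by (rule poly_mapping_eqI)
  qed
  have fin: "finite (B \<rightarrow>\<^sub>E {..L})" using assms by (intro finite_PiE) auto
  show "finite (box_monomials B L)" using finite_imageD[OF finite_subset[OF im fin] inj] .
  have "card (box_monomials B L) \<le> card (B \<rightarrow>\<^sub>E {..L})"
    using card_inj_on_le[OF inj im fin] .
  then show "card (box_monomials B L) \<le> (L + 1) ^ card B"
    using assms by (simp add: card_PiE)
qed

lemma box_polys_mono: "L \<le> L' \<Longrightarrow> box_polys B L \<subseteq> box_polys B L'"
  unfolding box_polys_def box_monomials_def by (auto intro: order_trans)

lemma box_polys_mult:
  assumes "p \<in> box_polys B L" "q \<in> box_polys B L'"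
  shows "p * q \<in> box_polys B (L + L')"
  unfolding box_polys_def
proof clarify
  fix m assume "m \<in> Poly_Mapping.keys (p * q)"
  then obtain a b where ab: "m = a + b" "a \<in> Poly_Mapping.keys p" "b \<in> Poly_Mapping.keys q"
    using keys_mult[of p q] by blast
  then have "a \<in> box_monomials B L" "b \<in> box_monomials B L'"
    using assms by (auto simp: box_polys_def)
  then show "m \<in> box_monomials B (L + L')"
    using Poly_Mapping.keys_add[of a b] unfolding ab box_monomials_def
    by (auto simp: lookup_add add_mono)
qed

lemma box_polys_1: "1 \<in> box_polys B L"
  by (auto simp: box_polys_def box_monomials_def)

lemma box_polys_power: "p \<in> box_polys B L \<Longrightarrow> p ^ k \<in> box_polys B (k * L)"
  by (induction k) (auto intro: box_polys_1 box_polys_mult)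

lemma box_polys_prod:
  "finite I \<Longrightarrow> (\<And>i. i \<in> I \<Longrightarrow> f i \<in> box_polys B L) \<Longrightarrow> prod f I \<in> box_polys B (card I * L)"
  by (induction I rule: finite_induct) (auto intro: box_polys_1 box_polys_mult)

lemma polys_in_some_box:
  assumes "p \<in> polys K B"
  shows "\<exists>L. p \<in> box_polys B L"
proof -
  let ?L = "\<Sum>m\<in>Poly_Mapping.keys p. \<Sum>z\<in>Poly_Mapping.keys m. Poly_Mapping.lookup m z"
  have "Poly_Mapping.lookup m z \<le> ?L" if "m \<in> Poly_Mapping.keys p" for m z
  proof (cases "z \<in> Poly_Mapping.keys m")
    case True
    then have "Poly_Mapping.lookup m z \<le> (\<Sum>z\<in>Poly_Mapping.keys m. Poly_Mapping.lookup m z)"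
      by (intro member_le_sum) auto
    also have "\<dots> \<le> ?L"
      by (rule member_le_sum[OF that]) auto
    finally show ?thesis .
  qed (auto simp: in_keys_iff)
  then show ?thesis
    using assms by (intro exI[of _ ?L]) (auto simp: box_polys_def box_monomials_def polys_iff)
qed

lemma finite_common_box:
  assumes "finite F" "F \<subseteq> polys K B"
  shows "\<exists>L. F \<subseteq> box_polys B L"
  using assms
proof (induction F rule: finite_induct)
  case (insert p F)
  then obtain L L' where "F \<subseteq> box_polys B L" "p \<in> box_polys B L'"
    using polys_in_some_box[of p K B] by auto
  then have "insert p F \<subseteq> box_polys B (max L L')"
    using box_polys_mono[of L "max L L'" B] box_polys_mono[of L' "max L L'" B] by auto
  then show ?case by blast
qed simp

lemma cong_mult:
  assumes "ideal P (mpoly_ring K A)" "a - b \<in> P" "c - d \<in> P" "c \<in> polys K A" "b \<in> polys K A"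
  shows "a * c - b * d \<in> P"
proof -
  have "a * c - b * d = (a - b) * c + (c - d) * b" by (simp add: algebra_simps)
  then show ?thesis using ideal_mpolyD(3,6)[OF assms(1)] assms by simp
qed

lemma cong_power:
  assumes "ideal P (mpoly_ring K A)" "a - b \<in> P" "a \<in> polys K A" "b \<in> polys K A"
  shows "a ^ (k::nat) - b ^ k \<in> P"
proof (induction k)
  case 0 then show ?case using ideal_mpolyD(2)[OF assms(1)] by simp
next
  case (Suc k) then show ?case using cong_mult[OF assms(1,2) Suc] assms by simp
qed

lemma cong_prod:
  assumes "ideal P (mpoly_ring K A)"
    and "\<And>i. i \<in> I \<Longrightarrow> a i - b i \<in> P \<and> a i \<in> polys K A \<and> b i \<in> polys K A"
  shows "prod a I - prod b I \<in> P"
  using assms(2)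
proof (induction I rule: infinite_finite_induct)
  case (insert i I)
  have "a i * prod a I - b i * prod b I \<in> P"
    using insert by (intro cong_mult[OF assms(1)]) auto
  then show ?case using insert by simp
qed (use ideal_mpolyD(2)[OF assms(1)] in auto)

lemma cong_sum:
  assumes "ideal P (mpoly_ring K A)" "\<And>i. i \<in> I \<Longrightarrow> a i - b i \<in> P"
  shows "sum a I - sum b I \<in> P"
proof -
  have "(\<Sum>i\<in>I. a i - b i) \<in> P"
    using assms(2)
  proof (induction I rule: infinite_finite_induct)
    case (insert i I)
    then show ?case using ideal_mpolyD(3)[OF assms(1), of "a i - b i"] by simp
  qed (simp_all add: ideal_mpolyD(2)[OF assms(1)])
  then show ?thesis by (simp add: sum_subtractf)
qed

text \<open>
  The polynomials whose residue class modulo the prime \<open>P\<close> is a quotient of residue classes of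
  polynomials in \<open>B\<close>, written without a field of fractions.
\<close>

definition fractions_modulo ::
  "'k::field itself \<Rightarrow> ('x, 'k) mpoly set \<Rightarrow> 'x set \<Rightarrow> ('x, 'k) mpoly set" where
  "fractions_modulo K P B = {g. \<exists>f\<in>polys K B - P. \<exists>h\<in>polys K B. f * g - h \<in> P}"

text \<open>
  Quotients can be added and multiplied; the product of two denominators stays outside \<open>P\<close>
  because \<open>P\<close> is prime.
\<close>

lemma polys_subset_fractions_modulo:
  assumes prime: "primeideal P (mpoly_ring K A)" and "B \<subseteq> A"
    and gen: "\<And>z. z \<in> A \<Longrightarrow> indet z \<in> fractions_modulo K P B"
    and "g \<in> polys K A"
  shows "g \<in> fractions_modulo K P B"
  using assms(4)
proof (induction rule: polys_induct)
  note id = primeideal_mpolyD(1)[OF prime]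
  have BA: "p \<in> polys K A" if "p \<in> polys K B" for p using polys_mono[OF assms(2)] that by blast
  {
    case (const c)
    show ?case unfolding fractions_modulo_def
      using primeideal_mpolyD(2)[OF prime] ideal_mpolyD(2)[OF id]
      by (intro CollectI bexI[of _ 1] bexI[of _ "const c"]) auto
  next
    case (indet z) then show ?case using gen by blast
  next
    case (add p q)
    then obtain f h f' h' where *: "f \<in> polys K B - P" "h \<in> polys K B" "f * p - h \<in> P"
      "f' \<in> polys K B - P" "h' \<in> polys K B" "f' * q - h' \<in> P"
      unfolding fractions_modulo_def by blast
    have "f * f' \<notin> P" using primeideal_mpolyD(3)[OF prime, of f f'] * BA by auto
    moreover have "f * f' * (p + q) - (h * f' + h' * f) = (f * p - h) * f' + (f' * q - h') * f"
      by (simp add: algebra_simps)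
    then have "f * f' * (p + q) - (h * f' + h' * f) \<in> P"
      using ideal_mpolyD(3,6)[OF id] * BA by simp
    ultimately show ?case unfolding fractions_modulo_def
      using * by (intro CollectI bexI[of _ "f * f'"] bexI[of _ "h * f' + h' * f"]) auto
  next
    case (mult p q)
    then obtain f h f' h' where *: "f \<in> polys K B - P" "h \<in> polys K B" "f * p - h \<in> P"
      "f' \<in> polys K B - P" "h' \<in> polys K B" "f' * q - h' \<in> P"
      unfolding fractions_modulo_def by blast
    have "f * f' \<notin> P" using primeideal_mpolyD(3)[OF prime, of f f'] * BA by auto
    moreover have "f * p * (f' * q) - h * h' \<in> P"
      using * BA mult by (intro cong_mult[OF id]) auto
    then have "f * f' * (p * q) - h * h' \<in> P" by (simp add: mult_ac)
    ultimately show ?case unfolding fractions_modulo_def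
      using * by (intro CollectI bexI[of _ "f * f'"] bexI[of _ "h * h'"]) auto
  }
qed

text \<open>
  The hypothesis on \<open>B\<close> bounds the transcendence degree of the residue ring of \<open>P 0\<close> by
  \<open>card B\<close>.  If \<open>m\<close> were larger, consider the \<open>D ^ m\<close> monomials of exponents below \<open>D\<close> in the
  independent elements \<open>g 0, \<dots>, g (m - 1)\<close>.  Multiplied by one common denominator, they become
  congruent to polynomials in \<open>B\<close> whose exponents grow linearly with \<open>D\<close>.  These span a space of
  dimension at most a constant times \<open>D ^ card B\<close>, so for large \<open>D\<close> there is a linear relation
  between the monomials, contrary to \<open>chain_independent\<close>.
\<close>

lemma prime_chain_length_le:
  fixes P :: "nat \<Rightarrow> ('x, 'k::field) mpoly set"
  assumes prime: "\<And>i. i \<le> m \<Longrightarrow> primeideal (P i) (mpoly_ring K A)"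
    and chain: "\<And>i. i < m \<Longrightarrow> P i \<subset> P (Suc i)"
    and B: "B \<subseteq> A" "finite B"
    and gen: "\<And>z. z \<in> A \<Longrightarrow> indet z \<in> fractions_modulo K (P 0) B"
  shows "m \<le> card B"
proof (rule ccontr)
  assume "\<not> m \<le> card B"
  then have m: "card B < m" by simp
  have p0: "primeideal (P 0) (mpoly_ring K A)" using prime by blast
  note id = primeideal_mpolyD(1)[OF p0]
  have BA: "p \<in> polys K A" if "p \<in> polys K B" for p using polys_mono[OF B(1)] that by blast
  have "\<exists>g. \<forall>i<m. g i \<in> P (Suc i) - P i" using chain by (intro choice) blast
  then obtain g where g: "\<And>i. i < m \<Longrightarrow> g i \<in> P (Suc i) - P i" by blast
  have gp: "g i \<in> polys K A" if "i < m" for i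
    using ideal_mpolyD(1)[OF primeideal_mpolyD(1)[OF prime[of "Suc i"]]] g[OF that] that by auto
  have "\<exists>f h. \<forall>i<m. f i \<in> polys K B - P 0 \<and> h i \<in> polys K B \<and> f i * g i - h i \<in> P 0"
    using polys_subset_fractions_modulo[OF p0 B(1) gen gp] unfolding fractions_modulo_def
    by (simp add: Bex_def flip: choice_iff') (metis DiffE)
  then obtain f h where fh: "\<And>i. i < m \<Longrightarrow> f i \<in> polys K B - P 0 \<and> h i \<in> polys K B \<and> f i * g i - h i \<in> P 0"
    by blast
  have "f ` {..<m} \<union> h ` {..<m} \<subseteq> polys K B" using fh by auto
  then obtain L where L: "f ` {..<m} \<union> h ` {..<m} \<subseteq> box_polys B L"
    by (metis finite_common_box finite_UnI finite_imageI finite_lessThan)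
  \<comment> \<open>large enough for \<open>(m D L + 1) ^ card B < D ^ (card B + 1)\<close>\<close>
  define D where "D = (m * L + 1) ^ card B + 1"
  define I where "I = ({..<m} \<rightarrow>\<^sub>E {..<D})"
  define J where "J = box_monomials B (m * (D * L))"
  define H where "H = (\<lambda>\<alpha>. \<Prod>i<m. h i ^ \<alpha> i * f i ^ (D - \<alpha> i))"
  have Hbox: "H \<alpha> \<in> box_polys B (m * (D * L))" if "\<alpha> \<in> I" for \<alpha>
  proof -
    have "h i ^ \<alpha> i * f i ^ (D - \<alpha> i) \<in> box_polys B (D * L)" if "i < m" for i
    proof -
      have "\<alpha> i < D" using \<open>\<alpha> \<in> I\<close> that by (auto simp: I_def)
      moreover have "h i ^ \<alpha> i * f i ^ (D - \<alpha> i) \<in> box_polys B (\<alpha> i * L + (D - \<alpha> i) * L)"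
        using L that by (intro box_polys_mult box_polys_power) auto
      ultimately show ?thesis by (simp flip: add_mult_distrib)
    qed
    then show ?thesis unfolding H_def
      using box_polys_prod[of "{..<m}" "\<lambda>i. h i ^ \<alpha> i * f i ^ (D - \<alpha> i)" B "D * L"] by simp
  qed
  have "card J \<le> (m * (D * L) + 1) ^ card B"
    unfolding J_def by (rule card_box_monomials(2)[OF B(2)])
  also have "\<dots> \<le> (D * (m * L + 1)) ^ card B"
    by (intro power_mono) (auto simp: D_def algebra_simps)
  also have "\<dots> = D ^ card B * (m * L + 1) ^ card B" by (simp only: power_mult_distrib)
  also have "\<dots> < D ^ card B * D" by (simp add: D_def)
  also have "\<dots> \<le> D ^ m"
    using m power_increasing[of "Suc (card B)" m D] by (simp add: D_def mult.commute)
  also have "D ^ m = card I" by (simp add: I_def card_PiE)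
  finally have "card J < card I" .
  moreover have "finite J" "finite I"
    by (auto simp: J_def I_def card_box_monomials(1)[OF B(2)] intro: finite_PiE)
  ultimately obtain c where c: "\<exists>\<alpha>\<in>I. c \<alpha> \<noteq> 0"
      "\<forall>\<mu>\<in>J. (\<Sum>\<alpha>\<in>I. c \<alpha> * Poly_Mapping.lookup (H \<alpha>) \<mu>) = 0"
    using homogeneous_system_solution[of J I "\<lambda>\<mu> \<alpha>. Poly_Mapping.lookup (H \<alpha>) \<mu>"] by blast
  have H0: "(\<Sum>\<alpha>\<in>I. const (c \<alpha>) * H \<alpha>) = 0"
  proof (rule poly_mapping_eqI)
    fix \<mu>
    have "Poly_Mapping.lookup (\<Sum>\<alpha>\<in>I. const (c \<alpha>) * H \<alpha>) \<mu> = (\<Sum>\<alpha>\<in>I. c \<alpha> * Poly_Mapping.lookup (H \<alpha>) \<mu>)"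
      by (simp add: lookup_sum lookup_const_mult)
    also have "\<dots> = 0"
    proof (cases "\<mu> \<in> J")
      case False
      then have "Poly_Mapping.lookup (H \<alpha>) \<mu> = 0" if "\<alpha> \<in> I" for \<alpha>
        using Hbox[OF that] by (auto simp: J_def box_polys_def in_keys_iff)
      then show ?thesis by simp
    qed (use c in blast)
    finally show "Poly_Mapping.lookup (\<Sum>\<alpha>\<in>I. const (c \<alpha>) * H \<alpha>) \<mu> = Poly_Mapping.lookup 0 \<mu>"
      by simp
  qed
  \<comment> \<open>the denominators \<open>f i\<close> occur in the monomials with exponents below \<open>D\<close>, so \<open>?F\<close> clears them all\<close>
  let ?F = "\<Prod>i<m. f i ^ D" and ?G = "\<lambda>\<alpha>. \<Prod>i\<in>{0..<m}. g i ^ \<alpha> i"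
  have fA: "f i \<in> polys K A" and hA: "h i \<in> polys K A" if "i < m" for i
    using fh[OF that] BA by auto
  have Gp: "?G \<alpha> \<in> polys K A" for \<alpha> by (intro polys_prod polys_power gp) auto
  have FGH: "?F * ?G \<alpha> - H \<alpha> \<in> P 0" if "\<alpha> \<in> I" for \<alpha>
  proof -
    have "f i ^ D * g i ^ \<alpha> i = (f i * g i) ^ \<alpha> i * f i ^ (D - \<alpha> i)" if "i < m" for i
    proof -
      have "\<alpha> i < D" using \<open>\<alpha> \<in> I\<close> that by (auto simp: I_def)
      then have "D = \<alpha> i + (D - \<alpha> i)" by simp
      then have "f i ^ D = f i ^ \<alpha> i * f i ^ (D - \<alpha> i)" by (metis power_add)
      then show ?thesis by (simp only: power_mult_distrib mult_ac)
    qed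
    then have "?F * ?G \<alpha> = (\<Prod>i<m. (f i * g i) ^ \<alpha> i * f i ^ (D - \<alpha> i))"
      unfolding lessThan_atLeast0 prod.distrib[symmetric] by (intro prod.cong) auto
    moreover have "(\<Prod>i<m. (f i * g i) ^ \<alpha> i * f i ^ (D - \<alpha> i)) - H \<alpha> \<in> P 0"
      unfolding H_def
    proof (intro cong_prod[OF id] conjI)
      fix i assume "i \<in> {..<m}"
      then have i: "i < m" by simp
      have "(f i * g i) ^ \<alpha> i - h i ^ \<alpha> i \<in> P 0"
        using fh[OF i] fA[OF i] gp[OF i] hA[OF i] by (intro cong_power[OF id]) auto
      then show "(f i * g i) ^ \<alpha> i * f i ^ (D - \<alpha> i) - h i ^ \<alpha> i * f i ^ (D - \<alpha> i) \<in> P 0"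
        using ideal_mpolyD(6)[OF id, of "(f i * g i) ^ \<alpha> i - h i ^ \<alpha> i" "f i ^ (D - \<alpha> i)"] fA[OF i]
        by (simp add: left_diff_distrib)
      show "(f i * g i) ^ \<alpha> i * f i ^ (D - \<alpha> i) \<in> polys K A" "h i ^ \<alpha> i * f i ^ (D - \<alpha> i) \<in> polys K A"
        using fA[OF i] gp[OF i] hA[OF i] by simp_all
    qed
    ultimately show ?thesis by simp
  qed
  have "(\<Sum>\<alpha>\<in>I. const (c \<alpha>) * (?F * ?G \<alpha>)) - (\<Sum>\<alpha>\<in>I. const (c \<alpha>) * H \<alpha>) \<in> P 0"
    using ideal_mpolyD(7)[OF id FGH] by (intro cong_sum[OF id]) (simp flip: right_diff_distrib)
  then have "?F * (\<Sum>\<alpha>\<in>I. const (c \<alpha>) * ?G \<alpha>) \<in> P 0"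
    by (simp only: H0 diff_zero sum_distrib_left mult.left_commute)
  moreover have "?F \<in> polys K A" using fA by (intro polys_prod) simp
  moreover have "(\<Sum>\<alpha>\<in>I. const (c \<alpha>) * ?G \<alpha>) \<in> polys K A"
    using Gp by (intro polys_sum polys_closed(4) const_in_polys)
  moreover have "?F \<notin> P 0"
  proof
    assume "?F \<in> P 0"
    then obtain i where i: "i < m" "f i ^ D \<in> P 0"
      using primeideal_prod[OF p0, of "\<lambda>i. f i ^ D" "{..<m}"] fA by blast
    then have "f i \<in> P 0" using primeideal_power[OF p0] fA by blast
    then show False using fh i(1) by blast
  qed
  ultimately have "(\<Sum>\<alpha>\<in>I. const (c \<alpha>) * ?G \<alpha>) \<in> P 0"
    using primeideal_mpolyD(3)[OF p0] by blast
  also have "(\<Sum>\<alpha>\<in>I. const (c \<alpha>) * ?G \<alpha>) = (\<Sum>\<alpha>\<in>{\<alpha>\<in>I. c \<alpha> \<noteq> 0}. const (c \<alpha>) * ?G \<alpha>)"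
    using \<open>finite I\<close> by (intro sum.mono_neutral_right) (auto simp: const_def)
  finally have in_P: "(\<Sum>\<alpha>\<in>{\<alpha>\<in>I. c \<alpha> \<noteq> 0}. const (c \<alpha>) * ?G \<alpha>) \<in> P 0" .
  have "inj_on (\<lambda>\<alpha>. restrict \<alpha> {0..<m}) {\<alpha>\<in>I. c \<alpha> \<noteq> 0}"
    by (rule inj_onI) (auto simp: I_def PiE_restrict lessThan_atLeast0)
  then have "(\<Sum>\<alpha>\<in>{\<alpha>\<in>I. c \<alpha> \<noteq> 0}. const (c \<alpha>) * ?G \<alpha>) \<notin> P 0"
    using prime chain g c(1) \<open>finite I\<close>
    by (intro chain_independent[where P = P and m = m and K = K and A = A and g = g and c = c]) auto
  then show False using in_P by blast
qed

section \<open>Substitution homomorphisms\<close>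

definition subst_monomial :: "('x \<Rightarrow> ('y, 'k::field) mpoly) \<Rightarrow> ('x \<Rightarrow>\<^sub>0 nat) \<Rightarrow> ('y, 'k) mpoly" where
  "subst_monomial \<sigma> m = (\<Prod>z\<in>Poly_Mapping.keys m. \<sigma> z ^ Poly_Mapping.lookup m z)"

definition subst :: "('x \<Rightarrow> ('y, 'k::field) mpoly) \<Rightarrow> ('x, 'k) mpoly \<Rightarrow> ('y, 'k) mpoly" where
  "subst \<sigma> p = (\<Sum>m\<in>Poly_Mapping.keys p. const (Poly_Mapping.lookup p m) * subst_monomial \<sigma> m)"

lemma subst_monomial_superset:
  "finite F \<Longrightarrow> Poly_Mapping.keys m \<subseteq> F \<Longrightarrow> subst_monomial \<sigma> m = (\<Prod>z\<in>F. \<sigma> z ^ Poly_Mapping.lookup m z)"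
  unfolding subst_monomial_def by (intro prod.mono_neutral_left) (auto simp: not_in_keys_iff_lookup_eq_zero)

lemma subst_superset:
  "finite F \<Longrightarrow> Poly_Mapping.keys p \<subseteq> F \<Longrightarrow>
    subst \<sigma> p = (\<Sum>m\<in>F. const (Poly_Mapping.lookup p m) * subst_monomial \<sigma> m)"
  unfolding subst_def by (intro sum.mono_neutral_left) (auto simp: not_in_keys_iff_lookup_eq_zero const_def)

lemma subst_monomial_add: "subst_monomial \<sigma> (m + m') = subst_monomial \<sigma> m * subst_monomial \<sigma> m'"
proof -
  let ?F = "Poly_Mapping.keys m \<union> Poly_Mapping.keys m'"
  show ?thesis
    using Poly_Mapping.keys_add[of m m']
    by (simp add: subst_monomial_superset[of ?F] lookup_add power_add prod.distrib)
qed

lemma subst_add: "subst \<sigma> (p + q) = subst \<sigma> p + subst \<sigma> q"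
proof -
  let ?F = "Poly_Mapping.keys p \<union> Poly_Mapping.keys q"
  show ?thesis
    using Poly_Mapping.keys_add[of p q]
    by (simp add: subst_superset[of ?F] lookup_add const_def single_add distrib_right sum.distrib)
qed

lemma subst_zero: "subst \<sigma> 0 = 0"
  by (simp add: subst_def)

lemma subst_single: "subst \<sigma> (Poly_Mapping.single m c) = const c * subst_monomial \<sigma> m"
  by (simp add: subst_def const_def)

lemma subst_sum: "subst \<sigma> (sum f I) = (\<Sum>i\<in>I. subst \<sigma> (f i))"
  by (induction I rule: infinite_finite_induct) (simp_all add: subst_zero subst_add)

lemma subst_mult:
  fixes \<sigma> :: "'x \<Rightarrow> ('y, 'k::field) mpoly"
  shows "subst \<sigma> (p * q) = subst \<sigma> p * subst \<sigma> q"
proof -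
  have single: "subst \<sigma> (Poly_Mapping.single m c * Poly_Mapping.single m' c')
      = subst \<sigma> (Poly_Mapping.single m c) * subst \<sigma> (Poly_Mapping.single m' c')" for m m' c c'
    by (simp add: mult_single subst_single subst_monomial_add flip: const_mult)
  have "subst \<sigma> (sum f I * sum g J) = subst \<sigma> (sum f I) * subst \<sigma> (sum g J)"
    if "\<And>i j. subst \<sigma> (f i * g j) = subst \<sigma> (f i) * subst \<sigma> (g j)"
    for f g :: "('x \<Rightarrow>\<^sub>0 nat) \<Rightarrow> ('x, 'k) mpoly" and I J
    by (simp add: sum_product subst_sum that)
  from this[of "\<lambda>m. Poly_Mapping.single m (Poly_Mapping.lookup p m)"
      "\<lambda>m. Poly_Mapping.single m (Poly_Mapping.lookup q m)", OF single,
      of "Poly_Mapping.keys p" "Poly_Mapping.keys q"]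
  show ?thesis by (simp flip: poly_as_sum_of_monomials)
qed

lemma subst_const: "subst \<sigma> (const c) = const c"
  unfolding const_def[of c] subst_single by (simp add: subst_monomial_def const_def)

lemma subst_one: "subst \<sigma> 1 = 1"
  using subst_const[of \<sigma> 1] by (simp add: const_1)

lemma subst_indet: "subst \<sigma> (indet z) = \<sigma> z"
  by (simp add: indet_def subst_single const_1 subst_monomial_def)

lemma subst_diff: "subst \<sigma> (p - q) = subst \<sigma> p - subst \<sigma> q"
  using subst_add[of \<sigma> "p - q" q] by (simp add: algebra_simps)

lemma subst_subst: "subst \<tau> (subst \<sigma> p) = subst (\<lambda>z. subst \<tau> (\<sigma> z)) p"
proof -
  have "p \<in> polys TYPE('b) UNIV" by (simp add: polys_iff)
  then show ?thesis
    by (induction rule: polys_induct) (simp_all add: subst_const subst_indet subst_add subst_mult)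
qed

definition subst_kernel ::
  "'k::field itself \<Rightarrow> 'x set \<Rightarrow> ('x \<Rightarrow> ('y, 'k) mpoly) \<Rightarrow> ('x, 'k) mpoly set" where
  "subst_kernel K A \<sigma> = {p \<in> polys K A. subst \<sigma> p = 0}"

lemma ideal_mpolyI:
  assumes "P \<subseteq> polys K A" "0 \<in> P"
    and "\<And>p q. p \<in> P \<Longrightarrow> q \<in> P \<Longrightarrow> p + q \<in> P"
    and mult: "\<And>p r. p \<in> P \<Longrightarrow> r \<in> polys K A \<Longrightarrow> p * r \<in> P"
  shows "ideal P (mpoly_ring K A)"
proof -
  interpret cring "mpoly_ring K A" by (rule mpoly_ring_cring)
  have neg: "- p \<in> P" if "p \<in> P" for p
    using mult[OF that, of "- 1"] by simp
  show ?thesis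
  proof (rule idealI)
    show "ring (mpoly_ring K A)" by (rule ring_axioms)
    show "subgroup P (add_monoid (mpoly_ring K A))"
    proof (rule group.subgroupI[OF add.is_group])
      fix p assume "p \<in> P"
      then have "\<ominus>\<^bsub>mpoly_ring K A\<^esub> p \<in> P"
        using neg assms(1) by (auto simp: a_inv_mpoly_ring)
      then show "inv\<^bsub>add_monoid (mpoly_ring K A)\<^esub> p \<in> P"
        by (simp only: a_inv_def)
    next
      show "P \<subseteq> carrier (add_monoid (mpoly_ring K A))" using assms(1) by simp
      show "P \<noteq> {}" using assms(2) by blast
      fix p q assume "p \<in> P" "q \<in> P"
      then show "p \<otimes>\<^bsub>add_monoid (mpoly_ring K A)\<^esub> q \<in> P" using assms(3)[of p q] by simp
    qed
  next
    fix p r assume "p \<in> P" "r \<in> polys K A"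
    then have "p * r \<in> P" by (rule mult)
    then show "r \<otimes>\<^bsub>mpoly_ring K A\<^esub> p \<in> P" "p \<otimes>\<^bsub>mpoly_ring K A\<^esub> r \<in> P"
      by (simp_all add: mult.commute)
  qed
qed

text \<open>
  Indexing the indeterminates of the target by a linearly ordered type makes the target an
  integral domain.
\<close>

lemma primeideal_subst_kernel:
  fixes \<sigma> :: "'x \<Rightarrow> (nat, 'k::field) mpoly"
  shows "primeideal (subst_kernel K A \<sigma>) (mpoly_ring K A)"
proof (rule primeidealI)
  show "ideal (subst_kernel K A \<sigma>) (mpoly_ring K A)"
    by (rule ideal_mpolyI) (auto simp: subst_kernel_def subst_zero subst_add subst_mult)
  show "cring (mpoly_ring K A)" by (rule mpoly_ring_cring)
  have "1 \<notin> subst_kernel K A \<sigma>" by (simp add: subst_kernel_def subst_one)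
  then show "polys K A \<noteq> subst_kernel K A \<sigma>" using polys_closed(2) by blast
qed (auto simp: subst_kernel_def subst_mult)

section \<open>Krull dimension of a quotient ring\<close>

definition prime_chain_over :: "('a, 'b) ring_scheme \<Rightarrow> 'a set \<Rightarrow> nat \<Rightarrow> (nat \<Rightarrow> 'a set) \<Rightarrow> bool" where
  "prime_chain_over R I n p \<longleftrightarrow>
     (\<forall>i\<le>n. primeideal (p i) R \<and> I \<subseteq> p i) \<and> (\<forall>i<n. p i \<subset> p (Suc i))"

lemma (in ring) image_in_quotient_iff:
  assumes I: "ideal I R" and Q: "ideal Q R" "I \<subseteq> Q" and x: "x \<in> carrier R"
  shows "I +> x \<in> (+>) I ` Q \<longleftrightarrow> x \<in> Q"
proof
  assume "I +> x \<in> (+>) I ` Q"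
  then obtain q where q: "q \<in> Q" "I +> x = I +> q" by blast
  have "q \<in> carrier R" using q(1) ideal.Icarr[OF Q(1)] by blast
  then have "x \<ominus> q \<in> I" using quotient_eq_iff_same_a_r_cos[OF I x] q(2) by blast
  then have "(x \<ominus> q) \<oplus> q \<in> Q"
    using Q q additive_subgroup.a_closed[OF ideal.axioms(1)[OF Q(1)]] by blast
  then show "x \<in> Q" using x \<open>q \<in> carrier R\<close> by (simp add: a_minus_def a_assoc l_neg)
qed blast

lemma (in cring) primeideal_image_quotient:
  assumes I: "ideal I R" and Q: "primeideal Q R" "I \<subseteq> Q"
  shows "primeideal ((+>) I ` Q) (R Quot I)"
proof -
  interpret I: ideal I R by fact
  interpret Q: primeideal Q R by fact
  note iff = image_in_quotient_iff[OF I Q.ideal_axioms Q(2)]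
  show ?thesis
  proof (rule primeidealI)
    show "ideal ((+>) I ` Q) (R Quot I)"
      using ring_ideal_imp_quot_ideal[OF I Q.ideal_axioms] by simp
    show "cring (R Quot I)" using I.quotient_is_cring is_cring by blast
    show "carrier (R Quot I) \<noteq> (+>) I ` Q"
    proof
      assume eq: "carrier (R Quot I) = (+>) I ` Q"
      have "I +> \<one> \<in> carrier (R Quot I)"
        using ring_hom_closed[OF I.rcos_ring_hom] by simp
      then have "\<one> \<in> Q" using iff[OF one_closed] unfolding eq by blast
      then show False using Q.I_notcarr Q.one_imp_carrier by blast
    qed
  next
    fix a b assume ab: "a \<in> carrier (R Quot I)" "b \<in> carrier (R Quot I)"
      "a \<otimes>\<^bsub>R Quot I\<^esub> b \<in> (+>) I ` Q"
    obtain x y where xy: "x \<in> carrier R" "y \<in> carrier R" "a = I +> x" "b = I +> y"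
      using ab by (auto simp: FactRing_def A_RCOSETS_def')
    have "a \<otimes>\<^bsub>R Quot I\<^esub> b = I +> (x \<otimes> y)"
      using ring_hom_mult[OF I.rcos_ring_hom xy(1,2)] xy by simp
    then have "x \<otimes> y \<in> Q" using ab(3) iff[of "x \<otimes> y"] xy by auto
    then show "a \<in> (+>) I ` Q \<or> b \<in> (+>) I ` Q" using Q.I_prime[OF xy(1,2)] xy by auto
  qed
qed

text \<open>
  Taking images and preimages under the projection matches the primes of \<open>R Quot I\<close> with the
  primes of \<open>R\<close> above \<open>I\<close>, and preserves strict inclusions.
\<close>

lemma (in cring) krull_dim_quotient_eqI:
  assumes I: "ideal I R"
    and chain: "prime_chain_over R I N p"
    and bound: "\<And>m q. prime_chain_over R I m q \<Longrightarrow> m \<le> N"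
  shows "krull_dim (R Quot I) = enat N"
proof -
  interpret I: ideal I R by fact
  let ?S = "{n. \<exists>p :: nat \<Rightarrow> 'a set set. (\<forall>i\<le>n. primeideal (p i) (R Quot I)) \<and> (\<forall>i<n. p i \<subset> p (Suc i))}"
  have "N \<in> ?S"
  proof (intro CollectI exI[of _ "\<lambda>i. (+>) I ` p i"] conjI allI impI)
    fix i assume "i \<le> N"
    then show "primeideal ((+>) I ` p i) (R Quot I)"
      using chain by (intro primeideal_image_quotient[OF I]) (auto simp: prime_chain_over_def)
  next
    fix i assume i: "i < N"
    then have p: "primeideal (p i) R" "I \<subseteq> p i" "primeideal (p (Suc i)) R" "I \<subseteq> p (Suc i)" "p i \<subset> p (Suc i)"
      using chain by (auto simp: prime_chain_over_def)
    then obtain x where x: "x \<in> p (Suc i)" "x \<notin> p i" by blast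
    then have "x \<in> carrier R" using ideal.Icarr[OF primeideal.axioms(1)[OF p(3)]] by blast
    then have "I +> x \<notin> (+>) I ` p i"
      using image_in_quotient_iff[OF I primeideal.axioms(1)[OF p(1)] p(2)] x by blast
    then show "(+>) I ` p i \<subset> (+>) I ` p (Suc i)" using p(5) x(1) by blast
  qed
  moreover have "n \<le> N" if n: "n \<in> ?S" for n
  proof -
    obtain q where "\<forall>i\<le>n. primeideal (q i) (R Quot I)" "\<forall>i<n. q i \<subset> q (Suc i)"
      using n by blast
    then have q: "\<And>i. i \<le> n \<Longrightarrow> primeideal (q i) (R Quot I)" "\<And>i. i < n \<Longrightarrow> q i \<subset> q (Suc i)"
      by blast+
    let ?p = "\<lambda>i. {r \<in> carrier R. I +> r \<in> q i}"
    have "prime_chain_over R I n ?p"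
      unfolding prime_chain_over_def
    proof (intro conjI allI impI)
      fix i assume i: "i \<le> n"
      show "primeideal (?p i) R"
        using ring_hom_ring.primeideal_vimage[OF I.rcos_ring_hom_ring is_cring q(1)[OF i]] .
      show "I \<subseteq> ?p i"
      proof
        fix x assume x: "x \<in> I"
        then have "I +> x = I" using a_rcos_zero[OF I] by blast
        moreover have "\<zero>\<^bsub>R Quot I\<^esub> \<in> q i"
          using additive_subgroup.zero_closed[OF ideal.axioms(1)[OF primeideal.axioms(1)[OF q(1)[OF i]]]] .
        then have "I \<in> q i" by (simp add: FactRing_def)
        ultimately show "x \<in> ?p i" using x I.Icarr by auto
      qed
    next
      fix i assume i: "i < n"
      then obtain c where c: "c \<in> q (Suc i)" "c \<notin> q i" using q(2) by blast
      have "c \<in> carrier (R Quot I)"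
        using ideal.Icarr[OF primeideal.axioms(1)[OF q(1)[of "Suc i"]] c(1)] i by simp
      then obtain x where "x \<in> carrier R" "c = I +> x"
        by (auto simp: FactRing_def A_RCOSETS_def')
      then show "?p i \<subset> ?p (Suc i)" using c q(2)[OF i] by blast
    qed
    then show ?thesis using bound by blast
  qed
  ultimately show ?thesis
    unfolding krull_dim_def by (intro antisym SUP_least SUP_upper) simp_all
qed

section \<open>Components of a graph with deleted vertices\<close>

lemma comps_del_eq:
  "comps_del G T = (verts G - T) // {(a, b). a \<in> verts G - T \<and> b \<in> verts G - T \<and>
     (a, b) \<in> {(a, b). {a, b} \<in> edges G \<and> a \<in> verts G - T \<and> b \<in> verts G - T}\<^sup>*}"
proof -
  have "verts G \<inter> (verts G - T) = verts G - T" by blast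
  then show ?thesis by (simp add: comps_del_def components_def induced_def)
qed

lemma comps_del_equiv:
  "equiv (verts G - T) {(a, b). a \<in> verts G - T \<and> b \<in> verts G - T \<and>
     (a, b) \<in> {(a, b). {a, b} \<in> edges G \<and> a \<in> verts G - T \<and> b \<in> verts G - T}\<^sup>*}"
proof -
  let ?r = "{(a, b). {a, b} \<in> edges G \<and> a \<in> verts G - T \<and> b \<in> verts G - T}"
  have "sym ?r" by (auto simp: sym_def insert_commute)
  then have "sym (?r\<^sup>*)" by (rule sym_rtrancl)
  then show ?thesis by (auto simp: equiv_def refl_on_def sym_def trans_def)
qed

lemma comps_del_Union: "\<Union>(comps_del G T) = verts G - T"
  unfolding comps_del_eq by (rule Union_quotient[OF comps_del_equiv])

lemma comps_del_subset: "C \<in> comps_del G T \<Longrightarrow> C \<subseteq> verts G - T"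
  using comps_del_Union by fast

lemma comps_del_disjoint:
  "C \<in> comps_del G T \<Longrightarrow> D \<in> comps_del G T \<Longrightarrow> C \<noteq> D \<Longrightarrow> C \<inter> D = {}"
  unfolding comps_del_eq using quotient_disj[OF comps_del_equiv] by blast

lemma comps_del_unique:
  "C \<in> comps_del G T \<Longrightarrow> D \<in> comps_del G T \<Longrightarrow> a \<in> C \<Longrightarrow> a \<in> D \<Longrightarrow> C = D"
  using comps_del_disjoint by fast

lemma comps_del_nonempty: "C \<in> comps_del G T \<Longrightarrow> C \<noteq> {}"
  unfolding comps_del_eq using in_quotient_imp_non_empty[OF comps_del_equiv] by blast

lemma finite_comps_del:
  assumes "finite (verts G)"
  shows "finite (comps_del G T)"
proof -
  have "comps_del G T \<subseteq> Pow (verts G)" using comps_del_subset by fast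
  then show ?thesis using assms finite_subset by blast
qed

lemma comps_del_edge:
  assumes "C \<in> comps_del G T" "a \<in> C" "{a, b} \<in> edges G" "b \<in> verts G - T"
  shows "b \<in> C"
proof -
  have a: "a \<in> verts G - T" using assms comps_del_subset by fast
  show ?thesis
    using assms(1) unfolding comps_del_eq
  proof (rule quotientE)
    fix x assume "C = {(a, b). a \<in> verts G - T \<and> b \<in> verts G - T \<and>
     (a, b) \<in> {(a, b). {a, b} \<in> edges G \<and> a \<in> verts G - T \<and> b \<in> verts G - T}\<^sup>*} `` {x}"
    then show "b \<in> C" using a assms by (auto intro: rtrancl_into_rtrancl)
  qed
qed

text \<open>
  Induction along a path from \<open>a\<close> to \<open>b\<close> that avoids \<open>T\<close>.
\<close>

lemma comps_del_rel_induct: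
  assumes C: "C \<in> comps_del G T" "a \<in> C" "b \<in> C"
    and refl: "\<And>x. x \<in> verts G - T \<Longrightarrow> E x x"
    and step: "\<And>x y z. x \<in> verts G - T \<Longrightarrow> y \<in> verts G - T \<Longrightarrow> z \<in> verts G - T \<Longrightarrow>
        E x y \<Longrightarrow> {y, z} \<in> edges G \<Longrightarrow> E x z"
  shows "E a b"
proof -
  have "(a, b) \<in> {(a, b). {a, b} \<in> edges G \<and> a \<in> verts G - T \<and> b \<in> verts G - T}\<^sup>*"
    using quotient_eq_iff[OF comps_del_equiv, of C G T C a b] C unfolding comps_del_eq by blast
  moreover have "a \<in> verts G - T" using C comps_del_subset by fast
  ultimately show ?thesis
    by (induction rule: rtrancl_induct) (use refl step in blast)+
qed

lemma comps_del_label: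
  assumes "C \<in> comps_del G T" "a \<in> C" "b \<in> C"
    and "\<And>x y. x \<in> verts G - T \<Longrightarrow> y \<in> verts G - T \<Longrightarrow> {x, y} \<in> edges G \<Longrightarrow> l x = l y"
  shows "l a = l b"
  using assms(1-3) by (rule comps_del_rel_induct) (use assms(4) in auto)

lemma comps_del_neighbour:
  assumes "C \<in> comps_del G T" "a \<in> C" "b \<in> C" "a \<noteq> b"
  shows "\<exists>d\<in>C. {a, d} \<in> edges G"
proof (rule ccontr)
  assume *: "\<not> (\<exists>d\<in>C. {a, d} \<in> edges G)"
  have "(a = a) = (b = a)"
    using assms(1-3)
  proof (rule comps_del_label)
    fix x y assume xy: "x \<in> verts G - T" "y \<in> verts G - T" "{x, y} \<in> edges G"
    then show "(x = a) = (y = a)"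
      using * comps_del_edge[OF assms(1,2), of x] comps_del_edge[OF assms(1,2), of y] 
        by (metis insert_commute)
  qed
  then show False using assms(4) by simp
qed

lemma sum_card_comps_del:
  assumes "finite (verts G)"
  shows "(\<Sum>C\<in>comps_del G T. card C) = card (verts G - T)"
  unfolding comps_del_Union[symmetric]
proof (rule card_Union_disjoint[symmetric])
  show "pairwise disjnt (comps_del G T)"
    using comps_del_disjoint by (fastforce simp: pairwise_def disjnt_def)
  fix C assume "C \<in> comps_del G T"
  then show "finite C" using comps_del_subset assms by (metis finite_Diff finite_subset)
qed

lemma comps_del_representatives:
  assumes "finite (verts G)"
  obtains r where "\<And>C a. C \<in> comps_del G T \<Longrightarrow> a \<in> C \<Longrightarrow> r a \<in> C"
    and "\<And>C a b. C \<in> comps_del G T \<Longrightarrow> a \<in> C \<Longrightarrow> b \<in> C \<Longrightarrow> r a = r b"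
    and "card (r ` (verts G - T)) = num_comps G T"
proof -
  let ?W = "verts G - T"
  have "\<exists>f. \<forall>C\<in>comps_del G T. f C \<in> C" using comps_del_nonempty by (intro bchoice) fast
  then obtain f where f: "\<And>C. C \<in> comps_del G T \<Longrightarrow> f C \<in> C" by blast
  have "\<exists>g. \<forall>a\<in>?W. a \<in> g a \<and> g a \<in> comps_del G T"
    using comps_del_Union[of G T] by (intro bchoice) auto
  then obtain g where g: "\<And>a. a \<in> ?W \<Longrightarrow> a \<in> g a \<and> g a \<in> comps_del G T" by blast
  have g_eq: "g a = C" if "C \<in> comps_del G T" "a \<in> C" for a C
    using g[of a] that comps_del_subset[OF that(1)] comps_del_unique by fast
  have im: "(\<lambda>a. f (g a)) ` ?W = f ` comps_del G T"
  proof
    show "f ` comps_del G T \<subseteq> (\<lambda>a. f (g a)) ` ?W"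
    proof
      fix y assume "y \<in> f ` comps_del G T"
      then obtain C where C: "C \<in> comps_del G T" "y = f C" by blast
      then have "y = f (g (f C))" "f C \<in> ?W"
        using g_eq[OF C(1) f[OF C(1)]] comps_del_subset[OF C(1)] f[OF C(1)] by auto
      then show "y \<in> (\<lambda>a. f (g a)) ` ?W" by blast
    qed
  qed (use g in auto)
  have "inj_on f (comps_del G T)"
  proof (rule inj_onI)
    fix C D assume CD: "C \<in> comps_del G T" "D \<in> comps_del G T" "f C = f D"
    then have "f C \<in> C" "f C \<in> D" using f[of C] f[of D] by simp_all
    then show "C = D" using comps_del_unique CD by fast
  qed
  then have "card ((\<lambda>a. f (g a)) ` ?W) = num_comps G T"
    unfolding im num_comps_def by (rule card_image)
  moreover have "f (g a) \<in> C" if "C \<in> comps_del G T" "a \<in> C" for C a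
    using f[OF that(1)] g_eq[OF that] by simp
  moreover have "f (g a) = f (g b)" if "C \<in> comps_del G T" "a \<in> C" "b \<in> C" for C a b
    using g_eq that by simp
  ultimately show ?thesis by (rule that[of "\<lambda>a. f (g a)", rotated 2])
qed

section \<open>Krull dimensions attached to a graph\<close>

abbreviation bei_vars :: "'v ugraph \<Rightarrow> 'v xy set" where
  "bei_vars G \<equiv> Xv ` verts G \<union> Yv ` verts G"

abbreviation minor :: "'v \<Rightarrow> 'v \<Rightarrow> ('v xy, 'k::field) mpoly" where
  "minor a b \<equiv> indet (Xv a) * indet (Yv b) - indet (Xv b) * indet (Yv a)"

text \<open>
  The generators of \<open>P\<^sub>T\<close> spelled out: the complete graphs on the components only serve to say
  that all \<open>2\<close>-minors inside a component occur.
\<close>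

definition P_generators :: "'k::field itself \<Rightarrow> 'v ugraph \<Rightarrow> 'v set \<Rightarrow> ('v xy, 'k) mpoly set" where
  "P_generators K G T = {indet (Xv a) | a. a \<in> T} \<union> {indet (Yv a) | a. a \<in> T} \<union>
     {minor a b | a b C. C \<in> comps_del G T \<and> a \<in> C \<and> b \<in> C \<and> a \<noteq> b}"

lemma P_ideal_eq:
  fixes K :: "'k::field itself" and G :: "'v ugraph"
  shows "P_ideal K G T = genideal (bei_ring K G) (P_generators K G T)"
proof -
  have "edge_binomials K (complete_graph C) = {minor a b | a b. a \<in> C \<and> b \<in> C \<and> a \<noteq> b}" for C :: "'v set"
    by (fastforce simp: edge_binomials_def complete_graph_def doubleton_eq_iff)
  then have "indet ` (Xv ` T \<union> Yv ` T) \<union> (\<Union>C\<in>comps_del G T. edge_binomials K (complete_graph C))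
      = P_generators K G T"
    unfolding P_generators_def by auto
  then show ?thesis by (simp add: P_ideal_def)
qed

lemma genideal_mpoly_subset_iff:
  assumes "S \<subseteq> polys K A" "ideal P (mpoly_ring K A)"
  shows "genideal (mpoly_ring K A) S \<subseteq> P \<longleftrightarrow> S \<subseteq> P"
proof -
  interpret cring "mpoly_ring K A" by (rule mpoly_ring_cring)
  show ?thesis using genideal_self[OF assms(1)] genideal_minimal[OF assms(2)] by blast
qed

lemma ideal_genideal_mpoly:
  assumes "S \<subseteq> polys K A"
  shows "ideal (genideal (mpoly_ring K A) S) (mpoly_ring K A)"
proof -
  interpret cring "mpoly_ring K A" by (rule mpoly_ring_cring)
  show ?thesis using genideal_ideal[OF assms] .
qed

lemma minor_in_polys: "a \<in> verts G \<Longrightarrow> b \<in> verts G \<Longrightarrow> minor a b \<in> polys K (bei_vars G)"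
  by (intro polys_diff polys_closed(4) indet_in_polys) auto

lemma P_generators_in_polys:
  assumes "T \<subseteq> verts G"
  shows "P_generators K G T \<subseteq> polys K (bei_vars G)"
proof -
  have "minor a b \<in> polys K (bei_vars G)" if "C \<in> comps_del G T" "a \<in> C" "b \<in> C" for a b C
    using comps_del_subset[OF that(1)] that(2,3) by (intro minor_in_polys) auto
  then show ?thesis using assms unfolding P_generators_def by fast
qed

lemma ideal_P_ideal:
  assumes "T \<subseteq> verts G"
  shows "ideal (P_ideal K G T) (bei_ring K G)"
  unfolding P_ideal_eq bei_ring_def
  by (rule ideal_genideal_mpoly[OF P_generators_in_polys[OF assms]])

lemma P_ideal_subset_iff:
  assumes "T \<subseteq> verts G" "ideal P (bei_ring K G)"
  shows "P_ideal K G T \<subseteq> P \<longleftrightarrow> P_generators K G T \<subseteq> P"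
  using genideal_mpoly_subset_iff[OF P_generators_in_polys[OF assms(1)]] assms(2)
  unfolding P_ideal_eq bei_ring_def by blast

lemma edge_binomials_in_polys:
  assumes "simple_graph G"
  shows "edge_binomials K G \<subseteq> polys K (bei_vars G)"
proof -
  have "minor a b \<in> polys K (bei_vars G)" if "{a, b} \<in> edges G" for a b
    using assms that by (intro minor_in_polys) (auto simp: simple_graph_def)
  then show ?thesis unfolding edge_binomials_def by fast
qed

lemma ideal_bei:
  assumes "simple_graph G"
  shows "ideal (bei K G) (bei_ring K G)"
  unfolding bei_def bei_ring_def
  by (rule ideal_genideal_mpoly[OF edge_binomials_in_polys[OF assms]])

lemma bei_subset_iff:
  assumes "simple_graph G" "ideal P (bei_ring K G)"
  shows "bei K G \<subseteq> P \<longleftrightarrow> edge_binomials K G \<subseteq> P"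
  using genideal_mpoly_subset_iff[OF edge_binomials_in_polys[OF assms(1)]] assms(2)
  unfolding bei_def bei_ring_def by blast

lemma bei_subset_P_ideal:
  assumes G: "simple_graph G" and T: "T \<subseteq> verts G"
  shows "bei K G \<subseteq> P_ideal K G T"
proof -
  let ?I = "P_ideal K G T"
  have I: "ideal ?I (bei_ring K G)" by (rule ideal_P_ideal[OF T])
  note I' = ideal_mpolyD[OF I[unfolded bei_ring_def]]
  have gen: "P_generators K G T \<subseteq> ?I" using P_ideal_subset_iff[OF T I] by blast
  have "minor a b \<in> ?I" if e: "{a, b} \<in> edges G" for a b
  proof -
    have ab: "a \<in> verts G" "b \<in> verts G" "a \<noteq> b"
      using G e by (auto simp: simple_graph_def)
    have ind: "indet (Xv v) \<in> polys K (bei_vars G)" "indet (Yv v) \<in> polys K (bei_vars G)"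
      if "v \<in> verts G" for v using that by auto
    consider "a \<in> T" | "b \<in> T" | "a \<in> verts G - T" "b \<in> verts G - T" using ab by blast
    then show ?thesis
    proof cases
      case 1
      then have "indet (Xv a) \<in> ?I" "indet (Yv a) \<in> ?I" using gen unfolding P_generators_def by auto
      then show ?thesis using I'(5-7) ind ab by simp
    next
      case 2
      then have "indet (Xv b) \<in> ?I" "indet (Yv b) \<in> ?I" using gen unfolding P_generators_def by auto
      then show ?thesis using I'(5-7) ind ab by simp
    next
      case 3
      then obtain C where C: "C \<in> comps_del G T" "a \<in> C" using comps_del_Union[of G T] by blast
      then have "b \<in> C" using comps_del_edge e 3 by fast
      then show ?thesis using C ab gen unfolding P_generators_def by blast
    qed
  qed
  then show ?thesis
    unfolding bei_subset_iff[OF G I] edge_binomials_def by blast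
qed

text \<open>
  Modulo \<open>P\<close>, the indeterminates of \<open>T\<close> vanish, and each component \<open>C\<close> contributes at most
  \<open>card C + 1\<close> independent ones.  If all \<open>x\<^sub>a\<close> with \<open>a \<in> C\<close> vanish, the \<open>y\<^sub>a\<close> are left.  Otherwise some
  \<open>x\<^sub>c\<close> is nonzero, and \<open>y\<^sub>a = x\<^sub>a y\<^sub>c / x\<^sub>c\<close> is a quotient of polynomials in \<open>y\<^sub>c\<close> and the \<open>x\<^sub>b\<close>
  with \<open>b \<in> C\<close>.
\<close>

lemma P_generators_transcendence:
  fixes P :: "('v xy, 'k::field) mpoly set"
  assumes fin: "finite (verts G)" and T: "T \<subseteq> verts G"
    and P: "primeideal P (mpoly_ring K (bei_vars G))" and sub: "P_generators K G T \<subseteq> P"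
  shows "\<exists>B\<subseteq>bei_vars G. finite B \<and> card B \<le> card (verts G - T) + num_comps G T \<and>
    (\<forall>z\<in>bei_vars G. indet z \<in> fractions_modulo K P B)"
proof -
  let ?V = "bei_vars G"
  note I = ideal_mpolyD[OF primeideal_mpolyD(1)[OF P]]
  have "\<exists>f. \<forall>C\<in>comps_del G T. (\<exists>a\<in>C. indet (Xv a) \<notin> P) \<longrightarrow> f C \<in> C \<and> indet (Xv (f C)) \<notin> P"
    by (intro bchoice) blast
  then obtain f where f: "\<And>C a. C \<in> comps_del G T \<Longrightarrow> a \<in> C \<Longrightarrow> indet (Xv a) \<notin> P \<Longrightarrow>
      f C \<in> C \<and> indet (Xv (f C)) \<notin> P" by blast
  define BC where "BC C = (if \<forall>a\<in>C. indet (Xv a) \<in> P then Yv ` C else insert (Yv (f C)) (Xv ` C))" for C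
  define B where "B = (\<Union>C\<in>comps_del G T. BC C)"
  have Cfin: "finite C" if "C \<in> comps_del G T" for C
    using comps_del_subset[OF that] fin finite_subset by blast
  have BV: "B \<subseteq> ?V"
    unfolding B_def BC_def using f comps_del_subset by (auto split: if_splits) fast+
  have "card (BC C) \<le> card C + 1" if "C \<in> comps_del G T" for C
    using Cfin[OF that] card_image_le[of C Yv] card_image_le[of C Xv]
    by (auto simp: BC_def card_insert_if)
  then have "card B \<le> (\<Sum>C\<in>comps_del G T. card C + 1)"
    unfolding B_def using finite_comps_del[OF fin, of T]
    by (intro order_trans[OF card_UN_le] sum_mono)
  also have "\<dots> = card (verts G - T) + num_comps G T"
    unfolding sum.distrib by (simp add: sum_card_comps_del[OF fin] num_comps_def)
  finally have "card B \<le> card (verts G - T) + num_comps G T" .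
  moreover have finB: "finite B" using finite_subset[OF BV] fin by simp
  have triv: "indet z \<in> fractions_modulo K P B" if "indet z \<in> P \<or> z \<in> B" for z
  proof (cases "indet z \<in> P")
    case True
    then show ?thesis unfolding fractions_modulo_def
      using primeideal_mpolyD(2)[OF P] by (intro CollectI bexI[of _ 1] bexI[of _ 0]) auto
  next
    case False
    then show ?thesis unfolding fractions_modulo_def
      using primeideal_mpolyD(2)[OF P] I(2) that
      by (intro CollectI bexI[of _ 1] bexI[of _ "indet z"]) auto
  qed
  have "indet z \<in> fractions_modulo K P B" if z: "z \<in> ?V" for z
  proof -
    obtain a where a: "a \<in> verts G" "z = Xv a \<or> z = Yv a" using z by blast
    show ?thesis
    proof (cases "a \<in> T")
      case True
      then have "indet z \<in> P" using a(2) sub unfolding P_generators_def by blast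
      then show ?thesis using triv by blast
    next
      case False
      then obtain C where C: "C \<in> comps_del G T" "a \<in> C" using a(1) comps_del_Union[of G T] by blast
      show ?thesis
      proof (cases "\<forall>a\<in>C. indet (Xv a) \<in> P")
        case True
        then have "indet z \<in> P \<or> z \<in> B" using a(2) C unfolding B_def BC_def by auto
        then show ?thesis using triv by blast
      next
        case False
        then have fC: "f C \<in> C" "indet (Xv (f C)) \<notin> P" using f[OF C(1)] by blast+
        have inB: "Yv (f C) \<in> B" "Xv ` C \<subseteq> B"
          using False C(1) by (auto simp: B_def BC_def)
        show ?thesis
        proof (cases "z \<in> B")
          case False
          then have z: "z = Yv a" "a \<noteq> f C" using a(2) inB C(2) by auto
          have "minor (f C) a \<in> P" using sub C fC(1) z(2) unfolding P_generators_def by blast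
          then have "indet (Xv (f C)) * indet z - indet (Xv a) * indet (Yv (f C)) \<in> P"
            using z by simp
          moreover have "indet (Xv a) * indet (Yv (f C)) \<in> polys K B" "indet (Xv (f C)) \<in> polys K B"
            using inB C(2) fC(1) by auto
          ultimately show ?thesis unfolding fractions_modulo_def using fC(2) by blast
        qed (use triv in blast)
      qed
    qed
  qed
  ultimately show ?thesis using BV finB by blast
qed

lemma prime_chain_over_P_ideal_le:
  assumes fin: "finite (verts G)" and T: "T \<subseteq> verts G"
    and chain: "prime_chain_over (bei_ring K G) I m p" and sub: "P_generators K G T \<subseteq> p 0"
  shows "m \<le> card (verts G - T) + num_comps G T"
proof -
  have prime: "\<And>i. i \<le> m \<Longrightarrow> primeideal (p i) (mpoly_ring K (bei_vars G))"
    and step: "\<And>i. i < m \<Longrightarrow> p i \<subset> p (Suc i)"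
    using chain unfolding prime_chain_over_def bei_ring_def by blast+
  obtain B where B: "B \<subseteq> bei_vars G" "finite B" "card B \<le> card (verts G - T) + num_comps G T"
    "\<And>z. z \<in> bei_vars G \<Longrightarrow> indet z \<in> fractions_modulo K (p 0) B"
    using P_generators_transcendence[OF fin T prime[OF le0] sub] by blast
  have "m \<le> card B" using prime step B(1,2,4) by (rule prime_chain_length_le)
  then show ?thesis using B(3) by simp
qed

text \<open>
  Vanishing of the minor of \<open>a\<close> and \<open>b\<close> modulo \<open>P\<close> says that the vectors \<open>(x\<^sub>a, y\<^sub>a)\<close> and
  \<open>(x\<^sub>b, y\<^sub>b)\<close> are proportional.  This relation is transitive among nonzero vectors, so from the
  edges it extends to all pairs in a component.
\<close>

lemma prime_over_bei_contains_P_generators: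
  fixes P :: "('v xy, 'k::field) mpoly set"
  assumes G: "simple_graph G" and P: "primeideal P (mpoly_ring K (bei_vars G))"
    and sub: "edge_binomials K G \<subseteq> P"
  shows "P_generators K G {v \<in> verts G. indet (Xv v) \<in> P \<and> indet (Yv v) \<in> P} \<subseteq> P"
    (is "P_generators K G ?T \<subseteq> P")
proof -
  note I = ideal_mpolyD[OF primeideal_mpolyD(1)[OF P]]
  have ind: "indet (Xv v) \<in> polys K (bei_vars G)" "indet (Yv v) \<in> polys K (bei_vars G)"
    if "v \<in> verts G" for v using that by auto
  have "minor a b \<in> P" if "C \<in> comps_del G ?T" "a \<in> C" "b \<in> C" for C a b
    using that
  proof (rule comps_del_rel_induct)
    fix x show "minor x x \<in> P" using I(2) by (simp add: mult.commute)
  next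
    fix x y z assume V: "x \<in> verts G - ?T" "y \<in> verts G - ?T" "z \<in> verts G - ?T"
      and xy: "minor x y \<in> P" and e: "{y, z} \<in> edges G"
    have yz: "minor y z \<in> P" using e sub unfolding edge_binomials_def by blast
    have "indet (Xv y) * minor x z = indet (Xv x) * minor y z + indet (Xv z) * (minor x y :: ('v xy, 'k) mpoly)"
      "indet (Yv y) * minor x z = indet (Yv z) * minor x y + indet (Yv x) * (minor y z :: ('v xy, 'k) mpoly)"
      by (simp_all add: algebra_simps)
    then have *: "indet (Xv y) * minor x z \<in> P" "indet (Yv y) * minor x z \<in> P"
      using I(3,7) xy yz ind V by simp_all
    moreover have "minor x z \<in> polys K (bei_vars G)" using V by (intro minor_in_polys) auto
    ultimately show "minor x z \<in> P"
      using primeideal_mpolyD(3)[OF P, of "indet (Xv y)" "minor x z"]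
        primeideal_mpolyD(3)[OF P, of "indet (Yv y)" "minor x z"] V(2) ind by blast
  qed
  then show ?thesis unfolding P_generators_def by auto
qed

text \<open>
  Send \<open>x\<^sub>a\<close> to \<open>z\<^sub>a\<close> and \<open>y\<^sub>a\<close> to \<open>z\<^sub>a w\<^sub>r\<close>, where \<open>r\<close> represents the component of \<open>a\<close>, and the
  indeterminates of \<open>T\<close> to zero.  Setting the parameters to zero one at a time enlarges the kernel.
  The enlargement is strict as long as each \<open>w\<^sub>r\<close> is killed before \<open>z\<^sub>r\<close>: the new element of the
  kernel is then the indeterminate \<open>x\<^sub>a\<close> or \<open>y\<^sub>r\<close> that corresponds to the parameter, since \<open>y\<^sub>r\<close> is
  sent to \<open>z\<^sub>r w\<^sub>r\<close>.  So the order is: first the \<open>z\<^sub>a\<close> of non-representatives, then all \<open>w\<^sub>r\<close>, and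
  finally the \<open>z\<^sub>r\<close>.
\<close>

lemma long_prime_chain_over_P_ideal:
  fixes K :: "'k::field itself" and G :: "'v ugraph"
  assumes fin: "finite (verts G)" and T: "T \<subseteq> verts G"
  shows "\<exists>p. prime_chain_over (bei_ring K G) (P_ideal K G T) (card (verts G - T) + num_comps G T) p"
proof -
  define W where "W = verts G - T"
  have finW: "finite W" using fin by (simp add: W_def)
  obtain r where r': "\<And>C a. C \<in> comps_del G T \<Longrightarrow> a \<in> C \<Longrightarrow> r a \<in> C"
    and r_eq: "\<And>C a b. C \<in> comps_del G T \<Longrightarrow> a \<in> C \<Longrightarrow> b \<in> C \<Longrightarrow> r a = r b"
    and card_r: "card (r ` W) = num_comps G T"
    using comps_del_representatives[OF fin, of T] unfolding W_def by blast
  have comp: "\<exists>C\<in>comps_del G T. a \<in> C" if "a \<in> W" for a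
    using that comps_del_Union[of G T] unfolding W_def by blast
  have rW: "r a \<in> W" if a: "a \<in> W" for a
  proof -
    obtain C where "C \<in> comps_del G T" "a \<in> C" using comp[OF a] by blast
    then show ?thesis using r' comps_del_subset unfolding W_def by fast
  qed
  have r_idem: "r (r a) = r a" if a: "a \<in> W" for a
  proof -
    obtain C where "C \<in> comps_del G T" "a \<in> C" using comp[OF a] by blast
    then show ?thesis using r' r_eq by blast
  qed
  have finr: "finite (r ` W)" using finW by simp
  obtain l1 l2 l3 where l: "set l1 = Xv ` (W - r ` W)" "distinct l1"
    "set l2 = Yv ` r ` W" "distinct l2" "set l3 = Xv ` r ` W" "distinct l3"
    using finite_distinct_list[of "Xv ` (W - r ` W)"] finite_distinct_list[of "Yv ` r ` W"]
      finite_distinct_list[of "Xv ` r ` W"] finW by (metis finite_Diff finite_imageI)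
  define l where "l = l1 @ l2 @ l3"
  have dl: "distinct l" using l by (auto simp: l_def)
  have len: "length l = card W + num_comps G T"
  proof -
    have "length l1 = card (W - r ` W)" "length l2 = card (r ` W)" "length l3 = card (r ` W)"
      using l distinct_card[of l1] distinct_card[of l2] distinct_card[of l3]
      by (simp_all add: card_image inj_on_def)
    moreover have "card (W - r ` W) + card (r ` W) = card W"
      using rW finW by (metis add.commute card_mono card_Diff_subset finr image_subsetI le_add_diff_inverse)
    ultimately show ?thesis using card_r by (simp add: l_def)
  qed
  have setl: "Xv a \<in> set l" "Yv (r a) \<in> set l" if "a \<in> W" for a
    using that l rW by (auto simp: l_def)
  obtain e :: "'v xy \<Rightarrow> nat" where e: "inj_on e (set l)"
    using finite_imp_inj_to_nat_seg[of "set l"] by auto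
  define Z :: "nat \<Rightarrow> 'v xy \<Rightarrow> (nat, 'k) mpoly"
    where "Z k z = (if z \<in> set (take k l) then 0 else indet (e z))" for k z
  define \<sigma> where "\<sigma> k z = (case z of Xv a \<Rightarrow> if a \<in> W then Z k (Xv a) else 0
      | Yv a \<Rightarrow> if a \<in> W then Z k (Xv a) * Z k (Yv (r a)) else 0)" for k z
  define p where "p k = subst_kernel K (bei_vars G) (\<sigma> k)" for k
  have prime: "primeideal (p k) (bei_ring K G)" for k
    unfolding p_def bei_ring_def by (rule primeideal_subst_kernel)
  have indet0: "indet j \<noteq> (0 :: (nat, 'k) mpoly)" for j
    by (metis indet_def lookup_single_eq lookup_zero zero_neq_one)
  have contains: "P_ideal K G T \<subseteq> p k" for k
  proof -
    have "subst (\<sigma> k) g = 0" if "g \<in> P_generators K G T" for g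
    proof -
      have "subst (\<sigma> k) (indet (Xv a)) = 0" "subst (\<sigma> k) (indet (Yv a)) = 0" if "a \<in> T" for a
        using that by (simp_all add: subst_indet \<sigma>_def W_def)
      moreover have "subst (\<sigma> k) (minor a b) = 0" if "C \<in> comps_del G T" "a \<in> C" "b \<in> C" for a b C
        using r_eq[OF that] comps_del_subset[OF that(1)] that(2,3)
        by (auto simp: subst_diff subst_mult subst_indet \<sigma>_def W_def)
      ultimately show ?thesis using that unfolding P_generators_def by blast
    qed
    then have "P_generators K G T \<subseteq> p k"
      using P_generators_in_polys[OF T, of K] by (auto simp: p_def subst_kernel_def)
    then show ?thesis using P_ideal_subset_iff[OF T primeideal.axioms(1)[OF prime]] by blast
  qed
  have strict: "p k \<subset> p (Suc k)" if k: "k < length l" for k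
  proof
    \<comment> \<open>killing the next parameter factors through one more substitution, so kernels can only grow\<close>
    let ?\<psi> = "\<lambda>j. if j = e (l ! k) then 0 else indet j :: (nat, 'k) mpoly"
    have take: "set (take (Suc k) l) = insert (l ! k) (set (take k l))"
      using k by (simp add: take_Suc_conv_app_nth)
    have Z: "subst ?\<psi> (Z k z) = Z (Suc k) z" if "z \<in> set l" for z
      using e that k by (auto simp: Z_def subst_zero subst_indet take inj_on_def)
    have "(\<lambda>z. subst ?\<psi> (\<sigma> k z)) = \<sigma> (Suc k)"
      by (rule ext) (auto simp: \<sigma>_def subst_zero subst_mult Z setl split: xy.split)
    then have "subst (\<sigma> (Suc k)) q = subst ?\<psi> (subst (\<sigma> k) q)" for q
      by (simp add: subst_subst)
    then show "p k \<subseteq> p (Suc k)" by (auto simp: p_def subst_kernel_def subst_zero)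
    let ?z = "l ! k"
    have z: "?z \<in> set l" "?z \<notin> set (take k l)" "?z \<in> set (take (Suc k) l)"
      using k dl take by (auto simp: in_set_conv_nth nth_eq_iff_index_eq)
    have zV: "?z \<in> bei_vars G" using z(1) l rW by (auto simp: l_def W_def)
    have "\<sigma> k ?z \<noteq> 0 \<and> \<sigma> (Suc k) ?z = 0"
    proof (cases ?z)
      case (Xv a)
      then have "a \<in> W" using z(1) l rW by (auto simp: l_def)
      then show ?thesis using Xv z indet0 by (auto simp: \<sigma>_def Z_def)
    next
      case (Yv a)
      then have a: "a \<in> r ` W" using z(1) l by (auto simp: l_def)
      then have aW: "a \<in> W" and ra: "r a = a" using rW r_idem by auto
      have "Xv a \<notin> set (take k l)"
      proof
        assume "Xv a \<in> set (take k l)"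
        then obtain i where i: "i < k" "i < length l" "l ! i = Xv a"
          by (auto simp: in_set_conv_nth)
        have "length (l1 @ l2) \<le> i"
        proof (rule ccontr)
          assume "\<not> length (l1 @ l2) \<le> i"
          then have "l ! i \<in> set (l1 @ l2)"
            unfolding l_def append_assoc[symmetric] nth_append[of "l1 @ l2"] by (simp del: set_append)
          then show False using i(3) a l by auto
        qed
        then have "k = length (l1 @ l2) + (k - length (l1 @ l2))" using i(1) by simp
        then have "l ! k = l3 ! (k - length (l1 @ l2))"
          unfolding l_def append_assoc[symmetric] by (metis nth_append_length_plus)
        moreover have "k - length (l1 @ l2) < length l3" using k i(1) \<open>length (l1 @ l2) \<le> i\<close> by (simp add: l_def)
        ultimately have "l ! k \<in> set l3" by simp
        then show False using Yv l by auto
      qed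
      then show ?thesis using Yv z indet0 aW ra by (auto simp: \<sigma>_def Z_def)
    qed
    then have "indet ?z \<in> p (Suc k)" "indet ?z \<notin> p k"
      using zV by (auto simp: p_def subst_kernel_def subst_indet)
    then show "p k \<noteq> p (Suc k)" by blast
  qed
  have "prime_chain_over (bei_ring K G) (P_ideal K G T) (length l) p"
    using prime contains strict by (simp add: prime_chain_over_def)
  then show ?thesis unfolding len W_def by blast
qed

theorem krull_dim_P_ideal:
  assumes fin: "finite (verts G)" and T: "T \<subseteq> verts G"
  shows "krull_dim (bei_ring K G Quot P_ideal K G T) = enat (card (verts G - T) + num_comps G T)"
proof -
  interpret cring "bei_ring K G" unfolding bei_ring_def by (rule mpoly_ring_cring)
  obtain p where "prime_chain_over (bei_ring K G) (P_ideal K G T) (card (verts G - T) + num_comps G T) p"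
    using long_prime_chain_over_P_ideal[OF assms] by blast
  with ideal_P_ideal[OF T] show ?thesis
  proof (rule krull_dim_quotient_eqI)
    fix m q assume chain: "prime_chain_over (bei_ring K G) (P_ideal K G T) m q"
    then have "primeideal (q 0) (bei_ring K G)" "P_ideal K G T \<subseteq> q 0"
      by (simp_all add: prime_chain_over_def)
    then have "P_generators K G T \<subseteq> q 0"
      using P_ideal_subset_iff[OF T] primeideal.axioms(1) by blast
    then show "m \<le> card (verts G - T) + num_comps G T"
      by (rule prime_chain_over_P_ideal_le[OF assms chain])
  qed
qed

text \<open>
  Every prime above \<open>J\<^sub>G\<close> lies above some \<open>P\<^sub>T\<close>, so the dimension is the largest of the dimensions
  of the rings \<open>S/P\<^sub>T\<close>.
\<close>

theorem krull_dim_bei: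
  assumes G: "simple_graph G" and T: "T \<subseteq> verts G"
    and max: "\<And>T'. T' \<subseteq> verts G \<Longrightarrow>
      card (verts G - T') + num_comps G T' \<le> card (verts G - T) + num_comps G T"
  shows "krull_dim (bei_ring K G Quot bei K G) = enat (card (verts G - T) + num_comps G T)"
proof -
  interpret cring "bei_ring K G" unfolding bei_ring_def by (rule mpoly_ring_cring)
  have fin: "finite (verts G)" using G by (simp add: simple_graph_def)
  obtain p where "prime_chain_over (bei_ring K G) (P_ideal K G T) (card (verts G - T) + num_comps G T) p"
    using long_prime_chain_over_P_ideal[OF fin T] by blast
  then have "prime_chain_over (bei_ring K G) (bei K G) (card (verts G - T) + num_comps G T) p"
    using bei_subset_P_ideal[OF G T, of K] unfolding prime_chain_over_def by blast
  with ideal_bei[OF G] show ?thesis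
  proof (rule krull_dim_quotient_eqI)
    fix m q assume chain: "prime_chain_over (bei_ring K G) (bei K G) m q"
    then have q: "primeideal (q 0) (bei_ring K G)" "bei K G \<subseteq> q 0"
      by (simp_all add: prime_chain_over_def)
    let ?T = "{v \<in> verts G. indet (Xv v) \<in> q 0 \<and> indet (Yv v) \<in> q 0}"
    have "edge_binomials K G \<subseteq> q 0"
      using q bei_subset_iff[OF G] primeideal.axioms(1) by blast
    then have "P_generators K G ?T \<subseteq> q 0"
      using prime_over_bei_contains_P_generators[OF G] q(1) unfolding bei_ring_def by blast
    then have "m \<le> card (verts G - ?T) + num_comps G ?T"
      by (intro prime_chain_over_P_ideal_le[OF fin _ chain]) auto
    also have "\<dots> \<le> card (verts G - T) + num_comps G T" by (rule max) auto
    finally show "m \<le> card (verts G - T) + num_comps G T" .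
  qed
qed

section \<open>Cut sets and the number of components\<close>

text \<open>
  If all neighbours of \<open>i\<close> outside \<open>T\<close> lie in one component \<open>C0\<close> of \<open>G - T\<close>, label \<open>i\<close> by \<open>C0\<close> and
  every other vertex by its component.  The labels are constant on the components of
  \<open>G - (T - {i})\<close> and all components of \<open>G - T\<close> occur as labels, so restoring \<open>i\<close> does not
  lower the number of components.
\<close>

lemma cut_set_separates_neighbours:
  assumes G: "simple_graph G" and T: "T \<in> cut_sets G" and i: "i \<in> T"
  shows "\<exists>C\<in>comps_del G T. \<exists>D\<in>comps_del G T. C \<noteq> D \<and>
    (\<exists>a\<in>C. {i, a} \<in> edges G) \<and> (\<exists>b\<in>D. {i, b} \<in> edges G)"
proof (rule ccontr)
  assume neg: "\<not> ?thesis"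
  let ?N = "\<lambda>C. \<exists>a\<in>C. {i, a} \<in> edges G"
  have fin: "finite (verts G)" using G by (simp add: simple_graph_def)
  have TV: "T \<subseteq> verts G" and less: "num_comps G (T - {i}) < num_comps G T"
    using T i by (auto simp: cut_sets_def)
  have "\<exists>C0\<in>comps_del G T. \<forall>C\<in>comps_del G T. ?N C \<longrightarrow> C = C0"
  proof (cases "\<exists>C\<in>comps_del G T. ?N C")
    case True
    then show ?thesis using neg by blast
  next
    case False
    have "comps_del G T \<noteq> {}" using less by (auto simp: num_comps_def)
    then show ?thesis using False by blast
  qed
  then obtain C0 where C0: "C0 \<in> comps_del G T" "\<And>C. C \<in> comps_del G T \<Longrightarrow> ?N C \<Longrightarrow> C = C0"
    by blast
  have "\<exists>g. \<forall>a\<in>verts G - T. a \<in> g a \<and> g a \<in> comps_del G T"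
    using comps_del_Union[of G T] by (intro bchoice) auto
  then obtain g where g: "\<And>a. a \<in> verts G - T \<Longrightarrow> a \<in> g a \<and> g a \<in> comps_del G T" by blast
  define l where "l v = (if v = i then C0 else g v)" for v
  have l_edge: "l x = l y" if xy: "x \<in> verts G - (T - {i})" "y \<in> verts G - (T - {i})" "{x, y} \<in> edges G" for x y
  proof -
    have *: "g y = C0" if "y \<in> verts G - T" "{i, y} \<in> edges G" for y
      using g[OF that(1)] C0(2) that(2) by blast
    consider "x = i" "y = i" | "x = i" "y \<in> verts G - T" "y \<noteq> i" | "y = i" "x \<in> verts G - T" "x \<noteq> i"
      | "x \<in> verts G - T" "y \<in> verts G - T" "x \<noteq> i" "y \<noteq> i"
      using xy(1,2) i by blast
    then show ?thesis
    proof cases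
      case 2 then show ?thesis using * xy(3) by (simp add: l_def)
    next
      case 3 then show ?thesis using * xy(3) by (simp add: l_def insert_commute)
    next
      case 4
      then have "y \<in> g x" using comps_del_edge[of "g x" G T x y] g xy(3) by blast
      then have "g x = g y" using comps_del_unique g 4 by fast
      then show ?thesis using 4 by (simp add: l_def)
    qed simp
  qed
  have "comps_del G T \<subseteq> (\<lambda>D. l (SOME a. a \<in> D)) ` comps_del G (T - {i})"
  proof
    fix C assume C: "C \<in> comps_del G T"
    then obtain a where a: "a \<in> C" using comps_del_nonempty by fast
    then have aV: "a \<in> verts G - T" using C comps_del_subset by fast
    then obtain D where D: "D \<in> comps_del G (T - {i})" "a \<in> D"
      using comps_del_Union[of G "T - {i}"] by blast
    then have "(SOME a. a \<in> D) \<in> D" by (auto intro: someI)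
    then have "l (SOME a. a \<in> D) = l a" using comps_del_label[OF D(1), of _ a l] D(2) l_edge by blast
    also have "\<dots> = C"
    proof -
      have "g a = C" using comps_del_unique[of "g a" G T C a] g[OF aV] a C by blast
      then show ?thesis using aV i by (auto simp: l_def)
    qed
    finally show "C \<in> (\<lambda>D. l (SOME a. a \<in> D)) ` comps_del G (T - {i})" using D(1) by blast
  qed
  then have "num_comps G T \<le> num_comps G (T - {i})"
    unfolding num_comps_def by (rule surj_card_le[OF finite_comps_del[OF fin]])
  then show False using less by simp
qed

text \<open>
  If \<open>T\<close> is not a cut set, some \<open>i \<in> T\<close> can be restored without lowering the number of
  components, while the number of remaining vertices grows.
\<close>

lemma cut_set_maximises:
  assumes fin: "finite (verts G)" and "T \<subseteq> verts G"
  shows "\<exists>T'\<in>cut_sets G. card (verts G - T) + num_comps G T \<le> card (verts G - T') + num_comps G T'"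
  using assms(2)
proof (induction "card T" arbitrary: T rule: less_induct)
  case less
  show ?case
  proof (cases "T \<in> cut_sets G")
    case False
    then obtain i where i: "i \<in> T" "num_comps G T \<le> num_comps G (T - {i})"
      using less.prems by (auto simp: cut_sets_def not_less)
    have "finite T" using less.prems fin finite_subset by blast
    then have "card (T - {i}) < card T" using i(1) by (meson card_Diff1_less)
    then obtain T' where "T' \<in> cut_sets G"
      "card (verts G - (T - {i})) + num_comps G (T - {i}) \<le> card (verts G - T') + num_comps G T'"
      using less.hyps[of "T - {i}"] less.prems by blast
    moreover have "card (verts G - T) \<le> card (verts G - (T - {i}))"
      using fin by (intro card_mono) auto
    ultimately show ?thesis using i(2) by (intro bexI[of _ T']) auto
  qed blast
qed

section \<open>Bipartite complements of two-regular graphs\<close>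

text \<open>
  Here \<open>H\<close> is adjacency in a two-regular bipartite graph with sides \<open>X\<close> and \<open>Y\<close> that contains no
  cycle of length \<open>4\<close> or \<open>6\<close>, and \<open>G\<close> is its bipartite complement.  These are the only properties
  of the cycle \<open>C\<^sub>2\<^sub>n\<close> that enter the case analysis.  They are symmetric in \<open>X\<close> and \<open>Y\<close>, so every
  statement about one side also holds for the other.
\<close>

locale bipartite_complement =
  fixes G :: "'v ugraph" and X Y :: "'v set" and H :: "'v \<Rightarrow> 'v \<Rightarrow> bool" and n :: nat
  assumes finX: "finite X" and finY: "finite Y" and disj: "X \<inter> Y = {}"
    and verts_eq: "verts G = X \<union> Y"
    and edges_eq: "edges G = {{u, v} | u v. u \<in> X \<and> v \<in> Y \<and> \<not> H u v}"
    and cardX: "card X = n" and cardY: "card Y = n" and n5: "n \<ge> 5"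
    and degX: "u \<in> X \<Longrightarrow> card {v \<in> Y. H u v} = 2"
    and degY: "v \<in> Y \<Longrightarrow> card {u \<in> X. H u v} = 2"
    and no_square: "u \<in> X \<Longrightarrow> u' \<in> X \<Longrightarrow> u \<noteq> u' \<Longrightarrow> v \<in> Y \<Longrightarrow> v' \<in> Y \<Longrightarrow> v \<noteq> v' \<Longrightarrow>
      H u v \<Longrightarrow> H u v' \<Longrightarrow> H u' v \<Longrightarrow> H u' v' \<Longrightarrow> False"
    and no_hexagon: "u1 \<in> X \<Longrightarrow> u2 \<in> X \<Longrightarrow> u3 \<in> X \<Longrightarrow> v1 \<in> Y \<Longrightarrow> v2 \<in> Y \<Longrightarrow> v3 \<in> Y \<Longrightarrow>
      distinct [u1, u2, u3] \<Longrightarrow> distinct [v1, v2, v3] \<Longrightarrow>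
      H u1 v2 \<Longrightarrow> H u1 v3 \<Longrightarrow> H u2 v1 \<Longrightarrow> H u2 v3 \<Longrightarrow> H u3 v1 \<Longrightarrow> H u3 v2 \<Longrightarrow> False"
begin

lemma dual: "bipartite_complement G Y X (\<lambda>v u. H u v) n"
proof
  show "edges G = {{v, u} | v u. v \<in> Y \<and> u \<in> X \<and> \<not> H u v}"
    unfolding edges_eq by (auto simp: insert_commute)
  show "False" if "u \<in> Y" "u' \<in> Y" "u \<noteq> u'" "v \<in> X" "v' \<in> X" "v \<noteq> v'"
      "H v u" "H v' u" "H v u'" "H v' u'" for u u' v v'
    using no_square[of v v' u u'] that by blast
  show "False" if "u1 \<in> Y" "u2 \<in> Y" "u3 \<in> Y" "v1 \<in> X" "v2 \<in> X" "v3 \<in> X"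
      "distinct [u1, u2, u3]" "distinct [v1, v2, v3]"
      "H v2 u1" "H v3 u1" "H v1 u2" "H v3 u2" "H v1 u3" "H v2 u3" for u1 u2 u3 v1 v2 v3
    using no_hexagon[of v1 v2 v3 u1 u2 u3] that by blast
qed (use finX finY disj verts_eq cardX cardY n5 degX degY in auto)

lemma simple: "simple_graph G"
  using finX finY disj unfolding simple_graph_def verts_eq edges_eq by (auto simp: card_2_iff) blast

lemma edge_iff: "u \<in> X \<Longrightarrow> v \<in> Y \<Longrightarrow> {u, v} \<in> edges G \<longleftrightarrow> \<not> H u v"
  using disj unfolding edges_eq by (auto simp: doubleton_eq_iff)

lemma edge_from_X: "u \<in> X \<Longrightarrow> {u, d} \<in> edges G \<Longrightarrow> d \<in> Y \<and> \<not> H u d"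
  using disj unfolding edges_eq by (auto simp: doubleton_eq_iff)

lemma card_verts_minus: "card (verts G - T) = card (X - T) + card (Y - T)"
proof -
  have "verts G - T = (X - T) \<union> (Y - T)" using verts_eq by auto
  then show ?thesis using finX finY disj by (simp add: card_Un_disjoint Int_Diff disjoint_iff)
qed

lemma comp_elem: "C \<in> comps_del G T \<Longrightarrow> a \<in> C \<Longrightarrow> a \<in> X - T \<or> a \<in> Y - T"
  using comps_del_subset[of C G T] verts_eq by blast

lemma comp_of: "a \<in> X - T \<or> a \<in> Y - T \<Longrightarrow> \<exists>C\<in>comps_del G T. a \<in> C"
  using comps_del_Union[of G T] verts_eq by blast

lemma outside_comp:
  assumes "C \<in> comps_del G T" "u \<in> C" "u \<in> X" "v \<in> Y - T" "v \<notin> C"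
  shows "H u v"
  using comps_del_edge[OF assms(1,2), of v] assms edge_iff[of u v] verts_eq by blast

text \<open>
  All remaining vertices of \<open>Y\<close> outside the component of \<open>u\<close> are \<open>H\<close>-neighbours of \<open>u\<close>, and
  \<open>u\<close> has only two of them.
\<close>

lemma card_outside_comp:
  assumes "C \<in> comps_del G T" "u \<in> C" "u \<in> X"
  shows "card (Y - T - C) \<le> 2"
proof -
  have "Y - T - C \<subseteq> {v \<in> Y. H u v}" using outside_comp[OF assms] by blast
  then show ?thesis using card_mono[of "{v \<in> Y. H u v}"] finY degX[OF assms(3)] by fastforce
qed

lemma neighbour_in_comp:
  assumes "C \<in> comps_del G T" "u \<in> C" "u \<in> X" "b \<in> C" "b \<noteq> u"
  shows "\<exists>v\<in>C \<inter> Y. \<not> H u v"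
  using comps_del_neighbour[OF assms(1,2,4)] assms(5) edge_from_X[OF assms(3)] by blast

lemma comp_without_Y:
  assumes "C \<in> comps_del G T" "C \<inter> Y = {}"
  shows "\<exists>u\<in>X - T. C = {u}"
proof -
  obtain u where u: "u \<in> C" using comps_del_nonempty[OF assms(1)] by blast
  then have uX: "u \<in> X - T" using comp_elem[OF assms(1)] assms(2) by blast
  then have "b = u" if "b \<in> C" for b using neighbour_in_comp[OF assms(1) u _ that] assms(2) by blast
  then show ?thesis using u uX by blast
qed

lemma cut_neighbours:
  assumes "T \<in> cut_sets G" "u \<in> T" "u \<in> X"
  shows "\<exists>C\<in>comps_del G T. \<exists>D\<in>comps_del G T. \<exists>v w. C \<noteq> D \<and> v \<in> C \<inter> Y \<and> w \<in> D \<inter> Y \<and> \<not> H u v \<and> \<not> H u w"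
  using cut_set_separates_neighbours[OF simple assms(1,2)] edge_from_X[OF assms(3)] by blast

text \<open>
  Two different components that meet \<open>X\<close> would each miss at most two of the \<open>n \<ge> 5\<close> vertices of
  \<open>Y\<close>, which is absurd as they are disjoint.  Hence one component contains what remains of \<open>X\<close>, and
  the vertices of \<open>Y\<close> outside it are isolated.
\<close>

lemma comps_with_Y_kept:
  assumes T: "T \<subset> X"
  shows "\<exists>D\<in>comps_del G T. X - T \<subseteq> D \<and> num_comps G T = Suc (card (Y - D))"
proof -
  have TY: "Y - T = Y" using T disj by blast
  obtain u where u: "u \<in> X - T" using T by blast
  then obtain D where D: "D \<in> comps_del G T" "u \<in> D" using comp_of by blast
  have AD: "X - T \<subseteq> D"
  proof
    fix u' assume u': "u' \<in> X - T"
    then obtain D' where D': "D' \<in> comps_del G T" "u' \<in> D'" using comp_of by blast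
    have "D' = D"
    proof (rule ccontr)
      assume "D' \<noteq> D"
      then have "D' \<inter> D = {}" using comps_del_disjoint D D' by blast
      then have "Y = (Y - D) \<union> (Y - D')" by blast
      then have "n \<le> card (Y - D) + card (Y - D')"
        using cardY card_Un_le[of "Y - D" "Y - D'"] by simp
      moreover have "card (Y - D) \<le> 2" "card (Y - D') \<le> 2"
        using card_outside_comp[OF D] card_outside_comp[OF D'] u u' TY by auto
      ultimately show False using n5 by simp
    qed
    then show "u' \<in> D" using D' by simp
  qed
  interpret dual: bipartite_complement G Y X "\<lambda>v u. H u v" n by (rule dual)
  have single: "C = {v}" if C: "C \<in> comps_del G T" "C \<noteq> D" "v \<in> C" for C v
  proof -
    have "C \<inter> D = {}" using comps_del_disjoint C D by blast
    then have "C \<inter> X = {}" using comp_elem[OF C(1)] AD disj by blast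
    then show ?thesis using dual.comp_without_Y[OF C(1)] C(3) by blast
  qed
  have "comps_del G T = insert D ((\<lambda>v. {v}) ` (Y - D))"
  proof
    show "comps_del G T \<subseteq> insert D ((\<lambda>v. {v}) ` (Y - D))"
    proof
      fix C assume C: "C \<in> comps_del G T"
      show "C \<in> insert D ((\<lambda>v. {v}) ` (Y - D))"
      proof (cases "C = D")
        case False
        obtain v where v: "v \<in> C" using comps_del_nonempty[OF C] by blast
        then have "v \<notin> D" using comps_del_unique C D False by fast
        then have "v \<in> Y - D" using comp_elem[OF C v] AD by blast
        then show ?thesis using single[OF C False v] by blast
      qed simp
    qed
    show "insert D ((\<lambda>v. {v}) ` (Y - D)) \<subseteq> comps_del G T"
    proof
      fix C assume "C \<in> insert D ((\<lambda>v. {v}) ` (Y - D))"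
      then consider "C = D" | v where "v \<in> Y - D" "C = {v}" by blast
      then show "C \<in> comps_del G T"
      proof cases
        case 2
        then obtain E where E: "E \<in> comps_del G T" "v \<in> E" using comp_of[of v T] TY by blast
        then show ?thesis using single[OF E(1) _ E(2)] 2 by blast
      qed (use D in simp)
    qed
  qed
  moreover have "D \<notin> (\<lambda>v. {v}) ` (Y - D)" by blast
  moreover have "card ((\<lambda>v. {v}) ` (Y - D)) = card (Y - D)" by (intro card_image) (simp add: inj_on_def)
  ultimately have "num_comps G T = Suc (card (Y - D))" using finY by (simp add: num_comps_def)
  then show ?thesis using D AD by blast
qed

lemma value_empty: "card (verts G - {}) + num_comps G {} = 2 * n + 1"
proof -
  interpret dual: bipartite_complement G Y X "\<lambda>v u. H u v" n by (rule dual)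
  have "{} \<subset> X" using cardX n5 by auto
  then obtain D where D: "D \<in> comps_del G {}" "X \<subseteq> D" "num_comps G {} = Suc (card (Y - D))"
    using comps_with_Y_kept[of "{}"] by auto
  have "Y - D = {}"
  proof (rule ccontr)
    assume "Y - D \<noteq> {}"
    then obtain v where v: "v \<in> Y" "v \<notin> D" by blast
    then obtain E where E: "E \<in> comps_del G {}" "v \<in> E" using comp_of[of v "{}"] by blast
    then have "X - {} - E = X" using comps_del_disjoint[OF D(1) E(1)] D(2) v by blast
    then show False using dual.card_outside_comp[OF E v(1)] cardX n5 by simp
  qed
  then have "num_comps G {} = 1" using D(3) by (simp only: card.empty One_nat_def)
  then show ?thesis using card_verts_minus[of "{}"] cardX cardY by simp
qed

lemma value_X: "card (verts G - X) + num_comps G X = 2 * n"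
proof -
  interpret dual: bipartite_complement G Y X "\<lambda>v u. H u v" n by (rule dual)
  have single: "C = {v}" if C: "C \<in> comps_del G X" "v \<in> C" for C v
    using dual.comp_without_Y[OF C(1)] comp_elem[OF C(1)] C(2) disj by blast
  have "comps_del G X = (\<lambda>v. {v}) ` Y"
  proof
    show "comps_del G X \<subseteq> (\<lambda>v. {v}) ` Y"
    proof
      fix C assume C: "C \<in> comps_del G X"
      then obtain v where v: "v \<in> C" using comps_del_nonempty by fast
      then show "C \<in> (\<lambda>v. {v}) ` Y" using single[OF C v] comp_elem[OF C v] by blast
    qed
    show "(\<lambda>v. {v}) ` Y \<subseteq> comps_del G X"
    proof
      fix C assume "C \<in> (\<lambda>v. {v}) ` Y"
      then obtain v where v: "v \<in> Y" "C = {v}" by blast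
      then obtain E where "E \<in> comps_del G X" "v \<in> E" using comp_of[of v X] disj by blast
      then show "C \<in> comps_del G X" using single[of E v] v by simp
    qed
  qed
  then have "num_comps G X = card Y" by (simp add: num_comps_def card_image inj_on_def)
  moreover have "Y - X = Y" using disj by blast
  ultimately show ?thesis using card_verts_minus[of X] cardY by simp
qed

text \<open>
  Let \<open>D\<close> be the component containing \<open>X - T\<close>, and call the vertices of \<open>Y - D\<close> isolated; the claim
  is that \<open>card (X - T) + card (Y - D) = 3\<close>.  The cut condition provides an isolated vertex, and
  \<open>X - T\<close> consists of \<open>H\<close>-neighbours of it, hence has at most two elements.  If it is a single vertex
  \<open>u\<close>, the isolated vertices are the two \<open>H\<close>-neighbours of \<open>u\<close>.  If it has two elements, a second
  isolated vertex would create a square in \<open>H\<close>.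
\<close>

lemma value_proper_subset_of_X:
  assumes cut: "T \<in> cut_sets G" and T: "T \<noteq> {}" "T \<subset> X"
  shows "card (verts G - T) + num_comps G T = n + 4"
proof -
  interpret dual: bipartite_complement G Y X "\<lambda>v u. H u v" n by (rule dual)
  have TY: "Y - T = Y" using T disj by blast
  obtain D where D: "D \<in> comps_del G T" "X - T \<subseteq> D" "num_comps G T = Suc (card (Y - D))"
    using comps_with_Y_kept[OF T(2)] by blast
  obtain i where "i \<in> T" "i \<in> X" using T by blast
  then obtain C1 C2 v1 v2 where C: "C1 \<in> comps_del G T" "C2 \<in> comps_del G T" "C1 \<noteq> C2"
    "v1 \<in> C1 \<inter> Y" "v2 \<in> C2 \<inter> Y"
    using cut_neighbours[OF cut] by blast
  have "v1 \<notin> D \<or> v2 \<notin> D" using C D comps_del_unique by (metis IntD1)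
  then have YD: "Y - D \<noteq> {}" using C by blast
  have HA: "H u v" if "u \<in> X - T" "v \<in> Y - D" for u v
    using outside_comp[OF D(1), of u v] D(2) that TY by blast
  obtain u where u: "u \<in> X - T" using T by blast
  have le2: "card (Y - D) \<le> 2" using card_outside_comp[OF D(1), of u] u D(2) TY by auto
  have finA: "finite (X - T)" and finYD: "finite (Y - D)" using finX finY by auto
  obtain v where v: "v \<in> Y - D" using YD by blast
  have "X - T \<subseteq> {u \<in> X. H u v}" using HA v by blast
  then have A2: "card (X - T) \<le> 2" using degY[of v] v card_mono[of "{u \<in> X. H u v}" "X - T"] finX by simp
  have A0: "card (X - T) \<noteq> 0" using u finA by auto
  have YD0: "card (Y - D) \<noteq> 0" using YD finYD by auto
  have "card (X - T) + card (Y - D) = 3"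
  proof (cases "card (X - T) = 1")
    case True
    then have A: "X - T = {u}" using u by (metis card_1_singletonE singletonD)
    have "Y - D = {v \<in> Y. H u v}"
    proof
      show "Y - D \<subseteq> {v \<in> Y. H u v}" using HA u by blast
      show "{v \<in> Y. H u v} \<subseteq> Y - D"
      proof
        fix w assume w: "w \<in> {v \<in> Y. H u v}"
        have "w \<notin> D"
        proof
          assume "w \<in> D"
          moreover have "u \<noteq> w" using u w disj by blast
          ultimately obtain u' where u': "u' \<in> D" "u' \<in> X" "\<not> H u' w"
            using dual.neighbour_in_comp[OF D(1), of w u] w u D(2) by blast
          then have "u' \<in> X - T" using comps_del_subset[OF D(1)] by blast
          then have "u' = u" using A by blast
          then show False using u'(3) w by blast
        qed
        then show "w \<in> Y - D" using w by blast
      qed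
    qed
    then have "card (Y - D) = card {v \<in> Y. H u v}" by (rule arg_cong)
    also have "\<dots> = 2" using degX[of u] u by blast
    finally have "card (Y - D) = 2" .
    then show ?thesis using True by simp
  next
    case False
    then have A: "card (X - T) = 2" using A0 A2 by linarith
    then obtain u1 u2 where u12: "u1 \<in> X - T" "u2 \<in> X - T" "u1 \<noteq> u2" by (auto simp: card_2_iff)
    have "card (Y - D) \<noteq> 2"
    proof
      assume "card (Y - D) = 2"
      then obtain w1 w2 where "w1 \<in> Y - D" "w2 \<in> Y - D" "w1 \<noteq> w2" by (auto simp: card_2_iff)
      then show False using no_square[of u1 u2 w1 w2] u12 HA by blast
    qed
    then show ?thesis using A YD0 le2 by linarith
  qed
  then show ?thesis using card_verts_minus[of T] TY cardY D(3) by simp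
qed

text \<open>
  The set \<open>X - T - C\<close> consists of all \<open>H\<close>-neighbours \<open>u\<close> of \<open>v\<close>.  Such a \<open>u\<close> is not in \<open>T\<close>,
  because the cut condition would give it neighbours in both components that meet \<open>Y\<close>, and in
  \<open>C\<close> only \<open>v\<close> is available; and it is not in \<open>C\<close>, because it would be joined to \<open>v\<close> there.
\<close>

lemma card_two_removed:
  assumes cut: "T \<in> cut_sets G" and C: "C \<in> comps_del G T" "C \<inter> Y = {v}"
    and two: "\<And>E. E \<in> comps_del G T \<Longrightarrow> E \<inter> Y \<noteq> {} \<Longrightarrow> E = C \<or> E = C'"
  shows "card (X - T - C) = 2"
proof -
  interpret dual: bipartite_complement G Y X "\<lambda>v u. H u v" n by (rule dual)
  have v: "v \<in> C" "v \<in> Y" using C(2) by blast+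
  have "X - T - C = {u \<in> X. H u v}"
  proof
    show "X - T - C \<subseteq> {u \<in> X. H u v}" using dual.outside_comp[OF C(1) v] by blast
    show "{u \<in> X. H u v} \<subseteq> X - T - C"
    proof
      fix u assume u: "u \<in> {u \<in> X. H u v}"
      have "u \<notin> T"
      proof
        assume "u \<in> T"
        then obtain E1 E2 w1 w2 where E: "E1 \<in> comps_del G T" "E2 \<in> comps_del G T" "E1 \<noteq> E2"
          "w1 \<in> E1 \<inter> Y" "w2 \<in> E2 \<inter> Y" "\<not> H u w1" "\<not> H u w2"
          using cut_neighbours[OF cut] u by blast
        then have "E1 = C \<or> E2 = C" using two[of E1] two[of E2] by blast
        then have "w1 = v \<or> w2 = v" using E(4,5) C(2) by blast
        then show False using E u by blast
      qed
      moreover have "u \<notin> C"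
      proof
        assume "u \<in> C"
        moreover have "v \<noteq> u" using u v disj by blast
        ultimately obtain w where "w \<in> C \<inter> Y" "\<not> H u w"
          using neighbour_in_comp[OF C(1), of u v] u v by blast
        moreover from this have "w = v" using C(2) by blast
        ultimately show False using u by blast
      qed
      ultimately show "u \<in> X - T - C" using u by blast
    qed
  qed
  then show ?thesis using degY[OF v(2)] by simp
qed

text \<open>
  All remaining vertices of \<open>Y\<close> are \<open>H\<close>-neighbours of the isolated vertex \<open>u\<close>; by the cut condition
  there are two, \<open>v1\<close> and \<open>v2\<close>, in different components.  A component other than theirs and
  \<open>{u}\<close> would be a vertex of \<open>X\<close> completing a square with \<open>u\<close>, \<open>v1\<close>, \<open>v2\<close>.  So there are three
  components, and \<open>card_two_removed\<close> gives each of the components of \<open>v1\<close> and \<open>v2\<close> exactly one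
  vertex of \<open>X\<close>.
\<close>

lemma value_isolated_vertex:
  assumes cut: "T \<in> cut_sets G" and TX: "T \<inter> X \<noteq> {}"
    and u: "u \<in> X - T" "{u} \<in> comps_del G T"
  shows "card (verts G - T) + num_comps G T = 8"
proof -
  obtain C1 C2 v1 v2 where C: "C1 \<in> comps_del G T" "C2 \<in> comps_del G T" "C1 \<noteq> C2"
    "v1 \<in> C1 \<inter> Y" "v2 \<in> C2 \<inter> Y"
    using cut_neighbours[OF cut] TX by blast
  have C12: "C1 \<inter> C2 = {}" using comps_del_disjoint C by blast
  have uY: "u \<notin> Y" using u disj by blast
  have Hu: "H u v" if "v \<in> Y - T" for v
    using outside_comp[OF u(2) _ _ that] u(1) uY that by blast
  have vB: "v1 \<in> Y - T" "v2 \<in> Y - T"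
    using comp_elem[OF C(1), of v1] comp_elem[OF C(2), of v2] C disj by blast+
  have v12: "v1 \<noteq> v2" using C C12 by blast
  have "Y - T \<subseteq> {v1, v2}"
  proof -
    have "Y - T - {u} = Y - T" using uY by blast
    then have "card (Y - T) \<le> 2" using card_outside_comp[OF u(2)] u(1) by simp
    moreover have "{v1, v2} \<subseteq> Y - T" "card {v1, v2} = 2" using vB v12 by auto
    ultimately show ?thesis using card_seteq[of "Y - T" "{v1, v2}"] finY by simp
  qed
  then have B: "Y - T = {v1, v2}" using vB by blast
  have CY: "C1 \<inter> Y = {v1}" "C2 \<inter> Y = {v2}"
  proof -
    have "E \<inter> Y \<subseteq> {v1, v2}" if "E \<in> comps_del G T" for E
      using comps_del_subset[OF that] B by blast
    then show "C1 \<inter> Y = {v1}" "C2 \<inter> Y = {v2}" using C C12 by blast+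
  qed
  have two: "E = C1 \<or> E = C2" if E: "E \<in> comps_del G T" "E \<inter> Y \<noteq> {}" for E
  proof -
    obtain w where w: "w \<in> E" "w \<in> Y" using E(2) by blast
    then have "w = v1 \<or> w = v2" using comps_del_subset[OF E(1)] B by blast
    then show ?thesis using comps_del_unique[OF E(1) C(1)] comps_del_unique[OF E(1) C(2)] C w by blast
  qed
  have uC: "u \<notin> C1" "u \<notin> C2"
    using comps_del_unique[OF u(2) C(1)] comps_del_unique[OF u(2) C(2)] C uY by blast+
  have comps: "comps_del G T = {{u}, C1, C2}"
  proof -
    have "E \<in> {{u}, C1, C2}" if E: "E \<in> comps_del G T" for E
    proof (rule ccontr)
      assume nin: "E \<notin> {{u}, C1, C2}"
      then have "E \<inter> Y = {}" using two[OF E] by blast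
      then obtain e where e: "e \<in> X - T" "E = {e}" using comp_without_Y[OF E] by blast
      have "H e v1" "H e v2" using outside_comp[OF E, of e] e vB disj by blast+
      moreover have "e \<noteq> u" using e nin by blast
      ultimately show False using no_square[of e u v1 v2] e(1) u(1) vB v12 Hu by blast
    qed
    then show ?thesis using u(2) C by blast
  qed
  have c3: "num_comps G T = 3"
  proof -
    have "{u} \<noteq> C1" "{u} \<noteq> C2" using uC by blast+
    then show ?thesis unfolding num_comps_def comps using C(3) by simp
  qed
  have cover: "X - T \<subseteq> {u} \<union> C1 \<union> C2" using comp_of[of _ T] unfolding comps by blast
  have "X - T - C1 = insert u ((X - T) \<inter> C2)" "X - T - C2 = insert u ((X - T) \<inter> C1)"
    using cover C12 uC u(1) by blast+
  then have "card (insert u ((X - T) \<inter> C2)) = 2" "card (insert u ((X - T) \<inter> C1)) = 2"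
    using card_two_removed[OF cut C(1) CY(1) two] card_two_removed[OF cut C(2) CY(2), of C1] two by auto
  then have one: "card ((X - T) \<inter> C2) = 1" "card ((X - T) \<inter> C1) = 1"
    using finX uC by simp_all
  have "X - T = insert u (((X - T) \<inter> C1) \<union> ((X - T) \<inter> C2))" using cover u(1) by blast
  moreover have "card (insert u (((X - T) \<inter> C1) \<union> ((X - T) \<inter> C2))) = Suc (card (((X - T) \<inter> C1) \<union> ((X - T) \<inter> C2)))"
    using finX uC by simp
  moreover have "card (((X - T) \<inter> C1) \<union> ((X - T) \<inter> C2)) = 1 + 1"
    unfolding one[symmetric] using finX C12 by (subst card_Un_disjoint) (auto simp: one)
  ultimately have "card (X - T) = 3" by simp
  moreover have "card (Y - T) = 2" using B v12 by simp
  ultimately show ?thesis using card_verts_minus[of T] c3 by simp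
qed

text \<open>
  All pairs in \<open>(C \<inter> X) \<times> (C' \<inter> Y)\<close> are \<open>H\<close>-adjacent.  So both sets have at most two elements,
  and not both have two, as \<open>H\<close> contains no square.  If \<open>C \<inter> X\<close> is a singleton, then
  \<open>card_two_removed\<close>, with the sides exchanged, shows that \<open>C' \<inter> Y\<close> has two elements.
\<close>

lemma crossing_sizes:
  assumes cut: "T \<in> cut_sets G" and comps: "comps_del G T = {C, C'}" and ne: "C \<noteq> C'"
    and elems: "u \<in> C" "u \<in> X" "v \<in> C'" "v \<in> Y"
  shows "card (C \<inter> X) + card (C' \<inter> Y) = 3"
proof -
  interpret dual: bipartite_complement G Y X "\<lambda>v u. H u v" n by (rule dual)
  have CC: "C \<in> comps_del G T" "C' \<in> comps_del G T" using comps by auto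
  have disjC: "C \<inter> C' = {}" using comps_del_disjoint[OF CC ne] .
  have YC: "Y - T - C = C' \<inter> Y" and XC: "X - T - C' = C \<inter> X"
    using comp_of[of _ T] comps_del_subset[OF CC(1)] comps_del_subset[OF CC(2)] disjC
    unfolding comps by auto
  have fin: "finite (C \<inter> X)" "finite (C' \<inter> Y)" using finX finY by auto
  have "card (C' \<inter> Y) \<le> 2" "card (C \<inter> X) \<le> 2"
    using card_outside_comp[OF CC(1) elems(1,2)] dual.card_outside_comp[OF CC(2) elems(3,4)] YC XC by auto
  moreover have "card (C \<inter> X) \<noteq> 0" "card (C' \<inter> Y) \<noteq> 0" using fin elems by auto
  moreover have "card (C' \<inter> Y) = 2" if one: "card (C \<inter> X) = 1"
  proof -
    obtain w where "C \<inter> X = {w}" using card_1_singletonE[OF one] by blast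
    then show ?thesis using dual.card_two_removed[OF cut CC(1), of w C'] comps YC by auto
  qed
  moreover have "card (C' \<inter> Y) \<noteq> 2" if two: "card (C \<inter> X) = 2"
  proof
    assume "card (C' \<inter> Y) = 2"
    then obtain w1 w2 where w: "w1 \<in> C' \<inter> Y" "w2 \<in> C' \<inter> Y" "w1 \<noteq> w2" by (auto simp: card_2_iff)
    obtain u1 u2 where u: "u1 \<in> C \<inter> X" "u2 \<in> C \<inter> X" "u1 \<noteq> u2" using two by (auto simp: card_2_iff)
    have "H a b" if "a \<in> C \<inter> X" "b \<in> C' \<inter> Y" for a b
      using outside_comp[OF CC(1), of a b] that YC by blast
    then show False using no_square[of u1 u2 w1 w2] u w by blast
  qed
  ultimately show ?thesis by linarith
qed

text \<open>
  Without isolated vertices every component meets both sides.  Three components would produce a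
  hexagon in \<open>H\<close>, so there are exactly two, and \<open>crossing_sizes\<close> counts three vertices for
  either way of crossing between them.
\<close>

lemma value_mixed:
  assumes cut: "T \<in> cut_sets G" and TX: "T \<inter> X \<noteq> {}" and TY: "T \<inter> Y \<noteq> {}"
  shows "card (verts G - T) + num_comps G T = 8"
proof -
  interpret dual: bipartite_complement G Y X "\<lambda>v u. H u v" n by (rule dual)
  show ?thesis
  proof (cases "(\<exists>u\<in>X - T. {u} \<in> comps_del G T) \<or> (\<exists>v\<in>Y - T. {v} \<in> comps_del G T)")
    case True
    then show ?thesis
      using value_isolated_vertex[OF cut TX] dual.value_isolated_vertex[OF cut TY] by blast
  next
    case False
    then have both: "\<exists>u v. u \<in> E \<and> u \<in> X \<and> v \<in> E \<and> v \<in> Y" if "E \<in> comps_del G T" for E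
      using comp_without_Y[OF that] dual.comp_without_Y[OF that] that by blast
    obtain C1 C2 where C: "C1 \<in> comps_del G T" "C2 \<in> comps_del G T" "C1 \<noteq> C2"
      using cut_neighbours[OF cut] TX by blast
    have comps: "comps_del G T = {C1, C2}"
    proof (rule ccontr)
      assume "comps_del G T \<noteq> {C1, C2}"
      then obtain C3 where C3: "C3 \<in> comps_del G T" "C3 \<noteq> C1" "C3 \<noteq> C2" using C by blast
      obtain u1 v1 u2 v2 u3 v3 where uv: "u1 \<in> C1" "u1 \<in> X" "v1 \<in> C1" "v1 \<in> Y"
        "u2 \<in> C2" "u2 \<in> X" "v2 \<in> C2" "v2 \<in> Y" "u3 \<in> C3" "u3 \<in> X" "v3 \<in> C3" "v3 \<in> Y"
        using both[OF C(1)] both[OF C(2)] both[OF C3(1)] by blast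
      have dj: "C1 \<inter> C2 = {}" "C1 \<inter> C3 = {}" "C2 \<inter> C3 = {}"
        using comps_del_disjoint C C3 by blast+
      have Hab: "H a b" if "E \<in> comps_del G T" "E' \<in> comps_del G T" "E \<inter> E' = {}"
          "a \<in> E" "a \<in> X" "b \<in> E'" "b \<in> Y" for a b E E'
        using outside_comp[OF that(1,4,5), of b] that comps_del_subset[OF that(2)] by blast
      have "H u1 v2" "H u1 v3" "H u2 v1" "H u2 v3" "H u3 v1" "H u3 v2"
        using Hab[OF C(1) C(2)] Hab[OF C(1) C3(1)] Hab[OF C(2) C(1)] Hab[OF C(2) C3(1)]
          Hab[OF C3(1) C(1)] Hab[OF C3(1) C(2)] uv dj by (auto simp: Int_commute)
      moreover have "distinct [u1, u2, u3]" "distinct [v1, v2, v3]" using uv dj by auto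
      ultimately show False using no_hexagon[of u1 u2 u3 v1 v2 v3] uv by blast
    qed
    obtain u1 v1 u2 v2 where uv: "u1 \<in> C1" "u1 \<in> X" "v1 \<in> C1" "v1 \<in> Y"
        "u2 \<in> C2" "u2 \<in> X" "v2 \<in> C2" "v2 \<in> Y"
      using both[OF C(1)] both[OF C(2)] by blast
    have dj: "C1 \<inter> C2 = {}" using comps_del_disjoint C by blast
    have "card (C1 \<inter> X) + card (C2 \<inter> Y) = 3"
      using crossing_sizes[OF cut comps C(3) uv(1,2,7,8)] .
    moreover have "card (C2 \<inter> X) + card (C1 \<inter> Y) = 3"
      using crossing_sizes[OF cut _ C(3)[symmetric] uv(5,6,3,4)] comps by blast
    moreover have "card (Z - T) = card (C1 \<inter> Z) + card (C2 \<inter> Z)" if "Z = X \<or> Z = Y" for Z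
    proof -
      have "Z - T = (C1 \<inter> Z) \<union> (C2 \<inter> Z)"
        using comp_of[of _ T] comps_del_subset[OF C(1)] comps_del_subset[OF C(2)] that
        unfolding comps by auto
      then show ?thesis using finX finY that dj by (auto intro!: card_Un_disjoint)
    qed
    ultimately show ?thesis
      using card_verts_minus[of T] C(3) by (simp add: num_comps_def comps)
  qed
qed

end

section \<open>The graph on 2n vertices\<close>

definition cycle_adjacent :: "nat \<Rightarrow> bvert \<Rightarrow> bvert \<Rightarrow> bool" where
  "cycle_adjacent n a b \<longleftrightarrow> (\<exists>i j. a = U i \<and> b = V j \<and> (j = i \<or> j = (i + n - 1) mod n))"

lemma pred_mod: "i < n \<Longrightarrow> (i + n - 1) mod n = (if i = 0 then n - 1 else i - 1)" for i n :: nat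
proof -
  assume i: "i < n"
  then show ?thesis by (cases i) simp_all
qed

lemma bipartite_complement_Gn:
  assumes n: "n \<ge> 5"
  shows "bipartite_complement (Gn n) (X_class n) (Y_class n) (cycle_adjacent n) n"
proof
  let ?X = "X_class n" and ?Y = "Y_class n" and ?H = "cycle_adjacent n"
  have H: "?H (U i) (V j) \<longleftrightarrow> j = i \<or> (i = 0 \<and> j = n - 1) \<or> (i \<noteq> 0 \<and> j = i - 1)" if "i < n" for i j
    using pred_mod[OF that] by (auto simp: cycle_adjacent_def)
  show "finite ?X" "finite ?Y" "?X \<inter> ?Y = {}" "verts (Gn n) = ?X \<union> ?Y" "n \<ge> 5"
    using n by (auto simp: X_class_def Y_class_def Gn_def)
  show "card ?X = n" "card ?Y = n"
    by (simp_all add: X_class_def Y_class_def card_image inj_on_def)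
  show "edges (Gn n) = {{u, v} | u v. u \<in> ?X \<and> v \<in> ?Y \<and> \<not> ?H u v}"
    unfolding Gn_def X_class_def Y_class_def cycle_adjacent_def by fastforce
  show "card {v \<in> ?Y. ?H u v} = 2" if u: "u \<in> ?X" for u
  proof -
    obtain i where i: "u = U i" "i < n" using u by (auto simp: X_class_def)
    have "{v \<in> ?Y. ?H u v} = {V i, V (if i = 0 then n - 1 else i - 1)}"
      using i by (auto simp: Y_class_def H)
    then show ?thesis using n i by auto
  qed
  show "card {u \<in> ?X. ?H u v} = 2" if v: "v \<in> ?Y" for v
  proof -
    obtain j where j: "v = V j" "j < n" using v by (auto simp: Y_class_def)
    have "{u \<in> ?X. ?H u v} = {U j, U (if j = n - 1 then 0 else j + 1)}"
      using j by (auto simp: X_class_def H split: if_splits)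
    then show ?thesis using n j by auto
  qed
  show False if uv: "u \<in> ?X" "u' \<in> ?X" "u \<noteq> u'" "v \<in> ?Y" "v' \<in> ?Y" "v \<noteq> v'"
    "?H u v" "?H u v'" "?H u' v" "?H u' v'" for u u' v v'
  proof -
    obtain i i' j j' where "u = U i" "u' = U i'" "v = V j" "v' = V j'" "i < n" "i' < n"
      using uv(1,2,4,5) by (auto simp: X_class_def Y_class_def)
    then show False using uv n by (auto simp: H)
  qed
  show False if uv: "u1 \<in> ?X" "u2 \<in> ?X" "u3 \<in> ?X" "v1 \<in> ?Y" "v2 \<in> ?Y" "v3 \<in> ?Y"
    "distinct [u1, u2, u3]" "distinct [v1, v2, v3]"
    "?H u1 v2" "?H u1 v3" "?H u2 v1" "?H u2 v3" "?H u3 v1" "?H u3 v2" for u1 u2 u3 v1 v2 v3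
  proof -
    obtain i1 i2 i3 j1 j2 j3 where eq: "u1 = U i1" "u2 = U i2" "u3 = U i3" "v1 = V j1" "v2 = V j2" "v3 = V j3"
      and less: "i1 < n" "i2 < n" "i3 < n"
      using uv(1-6) by (auto simp: X_class_def Y_class_def)
    let ?pred = "\<lambda>i. if i = 0 then n - 1 else i - 1"
    have consecutive: "i = ?pred i' \<or> i' = ?pred i"
      if "?H (U i) (V j)" "?H (U i') (V j)" "i \<noteq> i'" "i < n" "i' < n" for i i' j
      using that by (auto simp: H)
    have ne: "i1 \<noteq> i2" "i1 \<noteq> i3" "i2 \<noteq> i3" using uv(7) eq by auto
    have "i1 = ?pred i2 \<or> i2 = ?pred i1" "i1 = ?pred i3 \<or> i3 = ?pred i1" "i2 = ?pred i3 \<or> i3 = ?pred i2"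
      using consecutive[of i1 j3 i2] consecutive[of i1 j2 i3] consecutive[of i2 j1 i3] uv(9-14) ne less
      unfolding eq by blast+
    \<comment> \<open>three pairwise consecutive residues exist only modulo \<open>3\<close>\<close>
    then show False using ne less n by (auto split: if_splits)
  qed
qed

theorem theorem4p5:
  fixes K :: "'k::field itself" and n :: nat
  assumes "n \<ge> 5"
  shows "krull_dim (bei_ring K (Gn n) Quot bei K (Gn n)) = enat (2 * n + 1) \<and>
    (\<forall>T \<in> cut_sets (Gn n).
       (T = {} \<longrightarrow>
          krull_dim (bei_ring K (Gn n) Quot P_ideal K (Gn n) T) = enat (2 * n + 1)) \<and>
       (T = X_class n \<or> T = Y_class n \<longrightarrow>
          krull_dim (bei_ring K (Gn n) Quot P_ideal K (Gn n) T) = enat (2 * n)) \<and>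
       ((T \<noteq> {} \<and> T \<subset> X_class n) \<or> (T \<noteq> {} \<and> T \<subset> Y_class n) \<longrightarrow>
          krull_dim (bei_ring K (Gn n) Quot P_ideal K (Gn n) T) = enat (n + 4)) \<and>
       (T \<inter> X_class n \<noteq> {} \<and> T \<inter> Y_class n \<noteq> {} \<longrightarrow>
          krull_dim (bei_ring K (Gn n) Quot P_ideal K (Gn n) T) = enat 8))"
proof -
  let ?G = "Gn n" and ?X = "X_class n" and ?Y = "Y_class n"
  let ?f = "\<lambda>T. card (verts ?G - T) + num_comps ?G T"
  interpret bipartite_complement ?G ?X ?Y "cycle_adjacent n" n
    by (rule bipartite_complement_Gn[OF assms])
  interpret dual: bipartite_complement ?G ?Y ?X "\<lambda>v u. cycle_adjacent n u v" n
    by (rule dual)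
  have fin: "finite (verts ?G)" using simple by (simp add: simple_graph_def)
  have cutV: "T \<subseteq> ?X \<union> ?Y" if "T \<in> cut_sets ?G" for T
    using that verts_eq by (auto simp: cut_sets_def)
  have le: "?f T \<le> 2 * n + 1" if T: "T \<in> cut_sets ?G" for T
  proof -
    consider "T = {}" | "T = ?X" | "T = ?Y" | "T \<noteq> {}" "T \<subset> ?X" | "T \<noteq> {}" "T \<subset> ?Y"
      | "T \<inter> ?X \<noteq> {}" "T \<inter> ?Y \<noteq> {}"
      using cutV[OF T] by blast
    then show ?thesis
    proof cases
      case 1 then show ?thesis using value_empty by simp
    next
      case 2 then show ?thesis using value_X by simp
    next
      case 3 then show ?thesis using dual.value_X by simp
    next
      case 4 then show ?thesis using value_proper_subset_of_X[OF T] assms by simp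
    next
      case 5 then show ?thesis using dual.value_proper_subset_of_X[OF T] assms by simp
    next
      case 6 then show ?thesis using value_mixed[OF T] assms by simp
    qed
  qed
  have "?f T \<le> ?f {}" if T: "T \<subseteq> verts ?G" for T
    using cut_set_maximises[OF fin T] le value_empty by fastforce
  then have "krull_dim (bei_ring K ?G Quot bei K ?G) = enat (2 * n + 1)"
    using krull_dim_bei[OF simple, of "{}" K] value_empty by simp
  moreover have "krull_dim (bei_ring K ?G Quot P_ideal K ?G T) = enat (?f T)"
    if "T \<in> cut_sets ?G" for T
    using krull_dim_P_ideal[OF fin, of T K] cutV[OF that] verts_eq by simp
  ultimately show ?thesis
    using value_empty value_X dual.value_X value_proper_subset_of_X dual.value_proper_subset_of_X
      value_mixed by auto
qed

end
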